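(* Let $G$ be a group, $\mathbf X$ a $G$-category, $\mathbf Y$ a category, and let $F:\mathbf X\to\mathbf Y$, $U:\mathbf Y\to\mathbf X$ be an adjunction with $F$ left adjoint to $U$, unit $\eta:1_{\mathbf X}\to UF$ and counit $\varepsilon:FU\to 1_{\mathbf Y}$. Let $T=(UF,\eta,U\varepsilon F)$ be the induced monad on $\mathbf X$, and $K:\mathbf Y\to\mathbf X^T$, $K(Y)=(U(Y),U(\varepsilon_Y))$, the comparison functor. (a) Suppose the adjunction satisfies conditions (i) and (ii) of the definition of a $G$-Galois adjunction, and that $K$ has a left adjoint $L:\mathbf X^T\to\mathbf Y$. Then $L$ can be described on objects by $$L(X,\zeta)=F(X)/G,$$ where $F(X)$ is regarded as a $G$-object in $\mathbf Y$ via $g\mapsto F(\xi_g)=F(\zeta\eta_{g(X)}):F(X)\to F(X)$, with $\xi_g=\zeta\eta_{g(X)}:g(X)\to UF(g(X))=UF(X)\to X$. (b) If the adjunction is a $G$-Galois adjunction, then there is a category equivalence $$\mathbf Y\sim Z^1(G,\mathbf X),$$ under which an object $Y$ of $\mathbf Y$ corresponds to the $1$-cocycle $$\bigl(U(Y),(U(\varepsilon_Y)\,\eta_{g(U(Y))})_{g\in G}\bigr):G\to\mathbf X;$$ conversely, a $1$-cocycle $(X,\xi):G\to\mathbf X$ corresponds to the object $F(X)/G$, where $F(X)$ is regarded as a $G$-object in $\mathbf Y$ via $g\mapsto F(\xi_g):F(X)\to F(X)$.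
   Context: A $G$-category is a category $\mathbf X$ equipped with functors $g(-):\mathbf X\to\mathbf X$ ($g\in G$) such that $1(-)=1_{\mathbf X}$ and $(hg)(-)=h(-)\,g(-)$ (strict equalities). A $1$-cocycle $(X,\xi):G\to\mathbf X$ is an object $X$ of $\mathbf X$ with a family $\xi=(\xi_g)_{g\in G}$ of morphisms $\xi_g:g(X)\to X$ satisfying $\xi_1=1_X$ and $\xi_{hg}=\xi_h\,h(\xi_g)$ for all $g,h\in G$. A morphism $f:(X,\xi)\to(X',\xi')$ is a morphism $f:X\to X'$ in $\mathbf X$ with $f\xi_g=\xi'_g\,g(f)$ for all $g\in G$. This gives the category $Z^1(G,\mathbf X)$. The adjunction $(F,U,\eta,\varepsilon)$ is a $G$-Galois adjunction if: (i) $F(g(-))=F$ (equality of functors) for all $g\in G$; (ii) $\mathbf X$ admits $G$-indexed coproducts and, for each object $X$ of $\mathbf X$, the morphism $\gamma_X:\coprod_{g\in G}g(X)\to UF(X)$ induced by the morphisms $\eta_{g(X)}:g(X)\to UF(g(X))=UF(X)$ ($g\in G$) is an isomorphism; (iii) $U$ is monadic, i.e. $K$ is an equivalence of categories. $\mathbf X^T$ is the Eilenberg–Moore category of $T$-algebras $(X,\zeta)$, $\zeta:UF(X)\to X$. A $G$-object in $\mathbf Y$ is an object $Y$ with a group homomorphism $G\to\mathrm{Aut}(Y)$; for such a $Y$, $Y/G$ denotes the colimit of the corresponding functor from the one-object category $G$ to $\mathbf Y$, i.e. the universal morphism $Y\to Y/G$ coequalizing all the automorphisms of $Y$ given by elements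 of $G$. *)

theory Defs
  imports "HOL-Algebra.Group"
begin

section \<open>Categories, functors, natural transformations\<close>

record ('o, 'a) cat =
  Obj :: "'o set"
  Arr :: "'a set"
  Dom :: "'a \<Rightarrow> 'o"
  Cod :: "'a \<Rightarrow> 'o"
  Idn :: "'o \<Rightarrow> 'a"
  Comp :: "'a \<Rightarrow> 'a \<Rightarrow> 'a"  (infixl "\<cdot>\<index>" 70)

definition Hom :: "('o, 'a) cat \<Rightarrow> 'o \<Rightarrow> 'o \<Rightarrow> 'a set" where
  "Hom C A B = {f \<in> Arr C. Dom C f = A \<and> Cod C f = B}"

locale category =
  fixes C :: "('o, 'a) cat" (structure)
  assumes Dom_in: "f \<in> Arr C \<Longrightarrow> Dom C f \<in> Obj C"
    and Cod_in: "f \<in> Arr C \<Longrightarrow> Cod C f \<in> Obj C"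
    and Idn_in: "A \<in> Obj C \<Longrightarrow> Idn C A \<in> Hom C A A"
    and Comp_in: "\<lbrakk>f \<in> Hom C A B; g \<in> Hom C B D\<rbrakk> \<Longrightarrow> g \<cdot> f \<in> Hom C A D"
    and Comp_Idn: "f \<in> Hom C A B \<Longrightarrow> f \<cdot> Idn C A = f"
    and Idn_Comp: "f \<in> Hom C A B \<Longrightarrow> Idn C B \<cdot> f = f"
    and Comp_assoc: "\<lbrakk>f \<in> Hom C A B; g \<in> Hom C B D; h \<in> Hom C D E\<rbrakk>
                      \<Longrightarrow> (h \<cdot> g) \<cdot> f = h \<cdot> (g \<cdot> f)"

definition is_iso :: "('o, 'a) cat \<Rightarrow> 'a \<Rightarrow> bool" where
  "is_iso C f \<longleftrightarrow> f \<in> Arr C \<and>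
     (\<exists>g \<in> Hom C (Cod C f) (Dom C f).
        g \<cdot>\<^bsub>C\<^esub> f = Idn C (Dom C f) \<and> f \<cdot>\<^bsub>C\<^esub> g = Idn C (Cod C f))"

record ('o, 'a, 'p, 'b) fctr =
  fobj :: "'o \<Rightarrow> 'p"
  farr :: "'a \<Rightarrow> 'b"

locale cat_functor = source: category C + target: category D
  for C :: "('o, 'a) cat" and D :: "('p, 'b) cat" +
  fixes F :: "('o, 'a, 'p, 'b) fctr"
  assumes fobj_in: "A \<in> Obj C \<Longrightarrow> fobj F A \<in> Obj D"
    and farr_in: "f \<in> Hom C A B \<Longrightarrow> farr F f \<in> Hom D (fobj F A) (fobj F B)"
    and farr_Idn: "A \<in> Obj C \<Longrightarrow> farr F (Idn C A) = Idn D (fobj F A)"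
    and farr_Comp: "\<lbrakk>f \<in> Hom C A B; g \<in> Hom C B E\<rbrakk>
                     \<Longrightarrow> farr F (g \<cdot>\<^bsub>C\<^esub> f) = farr F g \<cdot>\<^bsub>D\<^esub> farr F f"

definition id_fctr :: "('o, 'a, 'o, 'a) fctr" where
  "id_fctr = \<lparr>fobj = (\<lambda>A. A), farr = (\<lambda>f. f)\<rparr>"

definition comp_fctr ::
  "('p, 'b, 'q, 'c) fctr \<Rightarrow> ('o, 'a, 'p, 'b) fctr \<Rightarrow> ('o, 'a, 'q, 'c) fctr"
  (infixl "\<bullet>" 75) where
  "S \<bullet> T = \<lparr>fobj = (\<lambda>A. fobj S (fobj T A)), farr = (\<lambda>f. farr S (farr T f))\<rparr>"

text \<open>Functors are total functions on the underlying types, so strict equality of functors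
  with source \<open>C\<close> means agreement on the objects and arrows of \<open>C\<close>.\<close>

definition fctr_eq ::
  "('o, 'a) cat \<Rightarrow> ('o, 'a, 'p, 'b) fctr \<Rightarrow> ('o, 'a, 'p, 'b) fctr \<Rightarrow> bool" where
  "fctr_eq C S T \<longleftrightarrow>
     (\<forall>A \<in> Obj C. fobj S A = fobj T A) \<and> (\<forall>f \<in> Arr C. farr S f = farr T f)"

definition nat_trans ::
  "('o, 'a) cat \<Rightarrow> ('p, 'b) cat \<Rightarrow> ('o, 'a, 'p, 'b) fctr \<Rightarrow> ('o, 'a, 'p, 'b) fctr
     \<Rightarrow> ('o \<Rightarrow> 'b) \<Rightarrow> bool" where
  "nat_trans C D S T \<alpha> \<longleftrightarrow>
     (\<forall>A \<in> Obj C. \<alpha> A \<in> Hom D (fobj S A) (fobj T A)) \<and>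
     (\<forall>A B. \<forall>f \<in> Hom C A B. \<alpha> B \<cdot>\<^bsub>D\<^esub> farr S f = farr T f \<cdot>\<^bsub>D\<^esub> \<alpha> A)"

definition nat_iso ::
  "('o, 'a) cat \<Rightarrow> ('p, 'b) cat \<Rightarrow> ('o, 'a, 'p, 'b) fctr \<Rightarrow> ('o, 'a, 'p, 'b) fctr
     \<Rightarrow> ('o \<Rightarrow> 'b) \<Rightarrow> bool" where
  "nat_iso C D S T \<alpha> \<longleftrightarrow> nat_trans C D S T \<alpha> \<and> (\<forall>A \<in> Obj C. is_iso D (\<alpha> A))"

definition quasi_inverse ::
  "('o, 'a) cat \<Rightarrow> ('p, 'b) cat \<Rightarrow> ('o, 'a, 'p, 'b) fctr \<Rightarrow> ('p, 'b, 'o, 'a) fctr \<Rightarrow> bool" where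
  "quasi_inverse C D S R \<longleftrightarrow> cat_functor C D S \<and> cat_functor D C R \<and>
     (\<exists>\<alpha>. nat_iso C C (R \<bullet> S) id_fctr \<alpha>) \<and> (\<exists>\<beta>. nat_iso D D (S \<bullet> R) id_fctr \<beta>)"

definition is_equivalence ::
  "('o, 'a) cat \<Rightarrow> ('p, 'b) cat \<Rightarrow> ('o, 'a, 'p, 'b) fctr \<Rightarrow> bool" where
  "is_equivalence C D S \<longleftrightarrow> (\<exists>R. quasi_inverse C D S R)"

text \<open>\<open>F\<close> is left adjoint to \<open>U\<close>, with unit \<open>\<eta>\<close> and counit \<open>\<epsilon>\<close>.\<close>

locale adjunction = left: cat_functor C D F + right: cat_functor D C U
  for C :: "('o, 'a) cat" and D :: "('p, 'b) cat"
    and F :: "('o, 'a, 'p, 'b) fctr" and U :: "('p, 'b, 'o, 'a) fctr" +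
  fixes \<eta> :: "'o \<Rightarrow> 'a" and \<epsilon> :: "'p \<Rightarrow> 'b"
  assumes unit: "nat_trans C C id_fctr (U \<bullet> F) \<eta>"
    and counit: "nat_trans D D (F \<bullet> U) id_fctr \<epsilon>"
    and triangle_F: "A \<in> Obj C \<Longrightarrow> \<epsilon> (fobj F A) \<cdot>\<^bsub>D\<^esub> farr F (\<eta> A) = Idn D (fobj F A)"
    and triangle_U: "B \<in> Obj D \<Longrightarrow> farr U (\<epsilon> B) \<cdot>\<^bsub>C\<^esub> \<eta> (fobj U B) = Idn C (fobj U B)"


section \<open>Coproducts, group objects and quotients by a group\<close>

definition is_coproduct ::
  "('o, 'a) cat \<Rightarrow> 'i set \<Rightarrow> ('i \<Rightarrow> 'o) \<Rightarrow> 'o \<Rightarrow> ('i \<Rightarrow> 'a) \<Rightarrow> bool" where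
  "is_coproduct C I A S \<iota> \<longleftrightarrow>
     S \<in> Obj C \<and> (\<forall>i \<in> I. \<iota> i \<in> Hom C (A i) S) \<and>
     (\<forall>B \<in> Obj C. \<forall>f. (\<forall>i \<in> I. f i \<in> Hom C (A i) B) \<longrightarrow>
        (\<exists>!u. u \<in> Hom C S B \<and> (\<forall>i \<in> I. u \<cdot>\<^bsub>C\<^esub> \<iota> i = f i)))"

definition has_coproducts :: "('o, 'a) cat \<Rightarrow> 'i set \<Rightarrow> bool" where
  "has_coproducts C I \<longleftrightarrow>
     (\<forall>A. (\<forall>i \<in> I. A i \<in> Obj C) \<longrightarrow> (\<exists>S \<iota>. is_coproduct C I A S \<iota>))"

definition cotuple ::
  "('o, 'a) cat \<Rightarrow> 'i set \<Rightarrow> 'o \<Rightarrow> ('i \<Rightarrow> 'a) \<Rightarrow> 'o \<Rightarrow> ('i \<Rightarrow> 'a) \<Rightarrow> 'a" where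
  "cotuple C I S \<iota> B f = (THE u. u \<in> Hom C S B \<and> (\<forall>i \<in> I. u \<cdot>\<^bsub>C\<^esub> \<iota> i = f i))"

definition Aut_group :: "('o, 'a) cat \<Rightarrow> 'o \<Rightarrow> 'a monoid" where
  "Aut_group C Y = \<lparr>carrier = {f \<in> Hom C Y Y. is_iso C f}, mult = Comp C, one = Idn C Y\<rparr>"

definition G_object :: "('o, 'a) cat \<Rightarrow> ('g, 'm) monoid_scheme \<Rightarrow> 'o \<Rightarrow> ('g \<Rightarrow> 'a) \<Rightarrow> bool" where
  "G_object C G Y \<rho> \<longleftrightarrow> Y \<in> Obj C \<and> \<rho> \<in> hom G (Aut_group C Y)"

text \<open>\<open>q : Y \<rightarrow> Q\<close> exhibits \<open>Q\<close> as \<open>Y/G\<close>. A cocone under the functor given by \<open>\<rho>\<close> on the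
  one-object category \<open>G\<close> is a single arrow out of \<open>Y\<close> that is invariant under all \<open>\<rho> g\<close>.\<close>

definition is_quotient ::
  "('o, 'a) cat \<Rightarrow> ('g, 'm) monoid_scheme \<Rightarrow> 'o \<Rightarrow> ('g \<Rightarrow> 'a) \<Rightarrow> 'o \<Rightarrow> 'a \<Rightarrow> bool" where
  "is_quotient C G Y \<rho> Q q \<longleftrightarrow>
     q \<in> Hom C Y Q \<and> (\<forall>g \<in> carrier G. q \<cdot>\<^bsub>C\<^esub> \<rho> g = q) \<and>
     (\<forall>B. \<forall>f \<in> Hom C Y B. (\<forall>g \<in> carrier G. f \<cdot>\<^bsub>C\<^esub> \<rho> g = f) \<longrightarrow>
        (\<exists>!u. u \<in> Hom C Q B \<and> u \<cdot>\<^bsub>C\<^esub> q = f))"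


section \<open>Algebras for a monad\<close>

text \<open>An arrow of the category of algebras carries its source and target algebras, since one
  arrow of \<open>C\<close> may underlie several algebra morphisms. The same holds for cocycles below.\<close>

definition EM_algebras ::
  "('o, 'a) cat \<Rightarrow> ('o, 'a, 'o, 'a) fctr \<Rightarrow> ('o \<Rightarrow> 'a) \<Rightarrow> ('o \<Rightarrow> 'a) \<Rightarrow> ('o \<times> 'a) set" where
  "EM_algebras C T \<eta> \<mu> =
     {(X, \<zeta>). X \<in> Obj C \<and> \<zeta> \<in> Hom C (fobj T X) X \<and>
        \<zeta> \<cdot>\<^bsub>C\<^esub> \<eta> X = Idn C X \<and> \<zeta> \<cdot>\<^bsub>C\<^esub> farr T \<zeta> = \<zeta> \<cdot>\<^bsub>C\<^esub> \<mu> X}"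

definition EM_cat ::
  "('o, 'a) cat \<Rightarrow> ('o, 'a, 'o, 'a) fctr \<Rightarrow> ('o \<Rightarrow> 'a) \<Rightarrow> ('o \<Rightarrow> 'a)
     \<Rightarrow> ('o \<times> 'a, ('o \<times> 'a) \<times> 'a \<times> ('o \<times> 'a)) cat" where
  "EM_cat C T \<eta> \<mu> =
     \<lparr>Obj = EM_algebras C T \<eta> \<mu>,
      Arr = {((X, \<zeta>), f, (X', \<zeta>')) | X \<zeta> f X' \<zeta>'.
               (X, \<zeta>) \<in> EM_algebras C T \<eta> \<mu> \<and> (X', \<zeta>') \<in> EM_algebras C T \<eta> \<mu> \<and>
               f \<in> Hom C X X' \<and> f \<cdot>\<^bsub>C\<^esub> \<zeta> = \<zeta>' \<cdot>\<^bsub>C\<^esub> farr T f},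
      Dom = (\<lambda>(a, f, b). a),
      Cod = (\<lambda>(a, f, b). b),
      Idn = (\<lambda>a. (a, Idn C (fst a), a)),
      Comp = (\<lambda>(b, g, c) (a, f, b'). (a, g \<cdot>\<^bsub>C\<^esub> f, c))\<rparr>"

text \<open>The Eilenberg--Moore category of the monad \<open>(UF, \<eta>, U\<epsilon>F)\<close>, and the comparison functor
  \<open>K Y = (U Y, U \<epsilon>\<^sub>Y)\<close>.\<close>

definition adj_EM_cat ::
  "('o, 'a) cat \<Rightarrow> ('o, 'a, 'p, 'b) fctr \<Rightarrow> ('p, 'b, 'o, 'a) fctr \<Rightarrow> ('o \<Rightarrow> 'a) \<Rightarrow> ('p \<Rightarrow> 'b)
     \<Rightarrow> ('o \<times> 'a, ('o \<times> 'a) \<times> 'a \<times> ('o \<times> 'a)) cat" where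
  "adj_EM_cat C F U \<eta> \<epsilon> = EM_cat C (U \<bullet> F) \<eta> (\<lambda>X. farr U (\<epsilon> (fobj F X)))"

definition comparison ::
  "('p, 'b) cat \<Rightarrow> ('p, 'b, 'o, 'a) fctr \<Rightarrow> ('p \<Rightarrow> 'b)
     \<Rightarrow> ('p, 'b, 'o \<times> 'a, ('o \<times> 'a) \<times> 'a \<times> ('o \<times> 'a)) fctr" where
  "comparison D U \<epsilon> =
     (let K\<^sub>0 = (\<lambda>Y. (fobj U Y, farr U (\<epsilon> Y)))
      in \<lparr>fobj = K\<^sub>0, farr = (\<lambda>f. (K\<^sub>0 (Dom D f), farr U f, K\<^sub>0 (Cod D f)))\<rparr>)"


section \<open>Categories with a strict group action, cocycles, Galois adjunctions\<close>

locale G_category = category C + group G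
  for G :: "('g, 'm) monoid_scheme" and C :: "('o, 'a) cat" +
  fixes act :: "'g \<Rightarrow> ('o, 'a, 'o, 'a) fctr"
  assumes act_functor: "g \<in> carrier G \<Longrightarrow> cat_functor C C (act g)"
    and act_one: "fctr_eq C (act \<one>\<^bsub>G\<^esub>) id_fctr"
    and act_mult: "\<lbrakk>h \<in> carrier G; g \<in> carrier G\<rbrakk>
                    \<Longrightarrow> fctr_eq C (act (h \<otimes>\<^bsub>G\<^esub> g)) (act h \<bullet> act g)"

text \<open>The families \<open>\<xi>\<close> are taken extensional on \<open>carrier G\<close>, so that equality of pairs is
  equality of cocycles.\<close>

definition cocycles ::
  "('g, 'm) monoid_scheme \<Rightarrow> ('o, 'a) cat \<Rightarrow> ('g \<Rightarrow> ('o, 'a, 'o, 'a) fctr)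
     \<Rightarrow> ('o \<times> ('g \<Rightarrow> 'a)) set" where
  "cocycles G C act =
     {(X, \<xi>). X \<in> Obj C \<and> \<xi> \<in> (\<Pi>\<^sub>E g \<in> carrier G. Hom C (fobj (act g) X) X) \<and>
        \<xi> \<one>\<^bsub>G\<^esub> = Idn C X \<and>
        (\<forall>g \<in> carrier G. \<forall>h \<in> carrier G. \<xi> (h \<otimes>\<^bsub>G\<^esub> g) = \<xi> h \<cdot>\<^bsub>C\<^esub> farr (act h) (\<xi> g))}"

definition Z1 ::
  "('g, 'm) monoid_scheme \<Rightarrow> ('o, 'a) cat \<Rightarrow> ('g \<Rightarrow> ('o, 'a, 'o, 'a) fctr)
     \<Rightarrow> ('o \<times> ('g \<Rightarrow> 'a), ('o \<times> ('g \<Rightarrow> 'a)) \<times> 'a \<times> ('o \<times> ('g \<Rightarrow> 'a))) cat" where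
  "Z1 G C act =
     \<lparr>Obj = cocycles G C act,
      Arr = {((X, \<xi>), f, (X', \<xi>')) | X \<xi> f X' \<xi>'.
               (X, \<xi>) \<in> cocycles G C act \<and> (X', \<xi>') \<in> cocycles G C act \<and>
               f \<in> Hom C X X' \<and>
               (\<forall>g \<in> carrier G. f \<cdot>\<^bsub>C\<^esub> \<xi> g = \<xi>' g \<cdot>\<^bsub>C\<^esub> farr (act g) f)},
      Dom = (\<lambda>(a, f, b). a),
      Cod = (\<lambda>(a, f, b). b),
      Idn = (\<lambda>a. (a, Idn C (fst a), a)),
      Comp = (\<lambda>(b, g, c) (a, f, b'). (a, g \<cdot>\<^bsub>C\<^esub> f, c))\<rparr>"

definition left_adjoint_invariant ::
  "('g, 'm) monoid_scheme \<Rightarrow> ('o, 'a) cat \<Rightarrow> ('g \<Rightarrow> ('o, 'a, 'o, 'a) fctr)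
     \<Rightarrow> ('o, 'a, 'p, 'b) fctr \<Rightarrow> bool" where
  "left_adjoint_invariant G C act F \<longleftrightarrow> (\<forall>g \<in> carrier G. fctr_eq C (F \<bullet> act g) F)"

text \<open>The \<open>cotuple\<close> below is \<open>\<gamma>\<^sub>X : \<Coprod>\<^sub>g g(X) \<rightarrow> UF(X)\<close>; its components are typed correctly because
  \<open>UF(g(X)) = UF(X)\<close> whenever \<open>left_adjoint_invariant\<close> holds.\<close>

definition unit_coproduct_condition ::
  "('g, 'm) monoid_scheme \<Rightarrow> ('o, 'a) cat \<Rightarrow> ('g \<Rightarrow> ('o, 'a, 'o, 'a) fctr)
     \<Rightarrow> ('o, 'a, 'p, 'b) fctr \<Rightarrow> ('p, 'b, 'o, 'a) fctr \<Rightarrow> ('o \<Rightarrow> 'a) \<Rightarrow> bool" where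
  "unit_coproduct_condition G C act F U \<eta> \<longleftrightarrow>
     has_coproducts C (carrier G) \<and>
     (\<forall>X \<in> Obj C. \<forall>S \<iota>. is_coproduct C (carrier G) (\<lambda>g. fobj (act g) X) S \<iota> \<longrightarrow>
        is_iso C (cotuple C (carrier G) S \<iota> (fobj U (fobj F X)) (\<lambda>g. \<eta> (fobj (act g) X))))"

definition monadic ::
  "('o, 'a) cat \<Rightarrow> ('p, 'b) cat \<Rightarrow> ('o, 'a, 'p, 'b) fctr \<Rightarrow> ('p, 'b, 'o, 'a) fctr
     \<Rightarrow> ('o \<Rightarrow> 'a) \<Rightarrow> ('p \<Rightarrow> 'b) \<Rightarrow> bool" where
  "monadic C D F U \<eta> \<epsilon> \<longleftrightarrow> is_equivalence D (adj_EM_cat C F U \<eta> \<epsilon>) (comparison D U \<epsilon>)"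

definition G_Galois_adjunction ::
  "('g, 'm) monoid_scheme \<Rightarrow> ('o, 'a) cat \<Rightarrow> ('g \<Rightarrow> ('o, 'a, 'o, 'a) fctr) \<Rightarrow> ('p, 'b) cat
     \<Rightarrow> ('o, 'a, 'p, 'b) fctr \<Rightarrow> ('p, 'b, 'o, 'a) fctr \<Rightarrow> ('o \<Rightarrow> 'a) \<Rightarrow> ('p \<Rightarrow> 'b) \<Rightarrow> bool" where
  "G_Galois_adjunction G C act D F U \<eta> \<epsilon> \<longleftrightarrow>
     adjunction C D F U \<eta> \<epsilon> \<and> left_adjoint_invariant G C act F \<and>
     unit_coproduct_condition G C act F U \<eta> \<and> monadic C D F U \<eta> \<epsilon>"

end

theory Submission imports Defs begin

text \<open>
  Condition (ii) says that \<open>UF(A)\<close> is the coproduct of the objects \<open>g(A)\<close>, with the units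
  \<open>\<eta>\<^bsub>g(A)\<^esub>\<close> as injections. Hence an arrow \<open>\<zeta> : UF(A) \<rightarrow> A\<close> is the same thing as the family
  \<open>\<xi>\<^sub>g = \<zeta> \<eta>\<^bsub>g(A)\<^esub>\<close>; under this bijection the algebra laws become the cocycle laws, because \<open>g(-)\<close> is
  invertible and so carries the coproduct \<open>UF(A)\<close> to a coproduct. The category of algebras is thus
  isomorphic to that of cocycles, over the base category. For the same reason an arrow
  \<open>f : F(A) \<rightarrow> B\<close> is invariant under all \<open>F(\<xi>\<^sub>g)\<close> iff its transpose \<open>A \<rightarrow> U(B)\<close> is an algebra morphism
  \<open>(A, \<zeta>) \<rightarrow> K(B)\<close>. So a universal arrow from \<open>(A, \<zeta>)\<close> to \<open>K\<close> is the transpose of a quotient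
  \<open>F(A) \<rightarrow> F(A)/G\<close>, and both a left adjoint and a quasi-inverse of \<open>K\<close> supply universal arrows.
\<close>

section \<open>Composition, isomorphisms and coproducts in a category\<close>

context category
begin

lemma Hom_iff: "f \<in> Hom C A B \<longleftrightarrow> f \<in> Arr C \<and> Dom C f = A \<and> Cod C f = B"
  by (simp add: Hom_def)

lemma Dom_Obj [simp]: "f \<in> Arr C \<Longrightarrow> Dom C f \<in> Obj C"
  by (rule Dom_in)

lemma Cod_Obj [simp]: "f \<in> Arr C \<Longrightarrow> Cod C f \<in> Obj C"
  by (rule Cod_in)

lemma Idn_typing [simp]:
  assumes "A \<in> Obj C"
  shows "Idn C A \<in> Arr C" "Dom C (Idn C A) = A" "Cod C (Idn C A) = A"
  using Idn_in[OF assms] by (auto simp: Hom_iff)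

lemma Comp_typing [simp]:
  assumes "f \<in> Arr C" "g \<in> Arr C" "Dom C g = Cod C f"
  shows "g \<cdot>\<^bsub>C\<^esub> f \<in> Arr C" "Dom C (g \<cdot>\<^bsub>C\<^esub> f) = Dom C f" "Cod C (g \<cdot>\<^bsub>C\<^esub> f) = Cod C g"
  using Comp_in[of f "Dom C f" "Cod C f" g "Cod C g"] assms by (auto simp: Hom_iff)

lemma Comp_Idn' [simp]: "f \<in> Arr C \<Longrightarrow> Dom C f = A \<Longrightarrow> f \<cdot>\<^bsub>C\<^esub> Idn C A = f"
  by (rule Comp_Idn) (simp add: Hom_iff)

lemma Idn_Comp' [simp]: "f \<in> Arr C \<Longrightarrow> Cod C f = B \<Longrightarrow> Idn C B \<cdot>\<^bsub>C\<^esub> f = f"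
  by (rule Idn_Comp) (simp add: Hom_iff)

lemma Comp_assoc' [simp]:
  "\<lbrakk>f \<in> Arr C; g \<in> Arr C; h \<in> Arr C; Dom C g = Cod C f; Dom C h = Cod C g\<rbrakk>
   \<Longrightarrow> (h \<cdot>\<^bsub>C\<^esub> g) \<cdot>\<^bsub>C\<^esub> f = h \<cdot>\<^bsub>C\<^esub> (g \<cdot>\<^bsub>C\<^esub> f)"
  by (rule Comp_assoc) (simp_all add: Hom_iff)

text \<open>The simplifier nests composites to the right, so an equation between two-fold composites
  no longer matches inside a longer one. This form lets such an equation act on the front of a
  right-nested composite.\<close>

lemma Comp_rewrite:
  assumes "g \<cdot>\<^bsub>C\<^esub> f = k" "f \<in> Arr C" "g \<in> Arr C" "x \<in> Arr C" "Dom C g = Cod C f" "Dom C f = Cod C x"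
  shows "g \<cdot>\<^bsub>C\<^esub> (f \<cdot>\<^bsub>C\<^esub> x) = k \<cdot>\<^bsub>C\<^esub> x"
  using assms by (metis Comp_assoc')

lemma iso_cancel_right:
  assumes "is_iso C i" "f \<in> Arr C" "g \<in> Arr C" "Dom C f = Cod C i" "Dom C g = Cod C i"
    and "f \<cdot>\<^bsub>C\<^esub> i = g \<cdot>\<^bsub>C\<^esub> i"
  shows "f = g"
proof -
  obtain j where i: "i \<in> Arr C" and j: "j \<in> Arr C" "Dom C j = Cod C i" "Cod C j = Dom C i"
    and ij: "i \<cdot>\<^bsub>C\<^esub> j = Idn C (Cod C i)"
    using assms(1) by (auto simp: is_iso_def Hom_iff)
  have "(f \<cdot>\<^bsub>C\<^esub> i) \<cdot>\<^bsub>C\<^esub> j = (g \<cdot>\<^bsub>C\<^esub> i) \<cdot>\<^bsub>C\<^esub> j" using assms(6) by simp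
  then show ?thesis using assms(2-5) i j ij by simp
qed

lemma iso_cancel_left:
  assumes "is_iso C i" "f \<in> Arr C" "g \<in> Arr C" "Cod C f = Dom C i" "Cod C g = Dom C i"
    and "i \<cdot>\<^bsub>C\<^esub> f = i \<cdot>\<^bsub>C\<^esub> g"
  shows "f = g"
proof -
  obtain j where i: "i \<in> Arr C" and j: "j \<in> Arr C" "Dom C j = Cod C i" "Cod C j = Dom C i"
    and ji: "j \<cdot>\<^bsub>C\<^esub> i = Idn C (Dom C i)"
    using assms(1) by (auto simp: is_iso_def Hom_iff)
  have "j \<cdot>\<^bsub>C\<^esub> (i \<cdot>\<^bsub>C\<^esub> f) = j \<cdot>\<^bsub>C\<^esub> (i \<cdot>\<^bsub>C\<^esub> g)" using assms(6) by simp
  then show ?thesis using assms(2-5) i j Comp_rewrite[OF ji] by simp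
qed

text \<open>Precomposition with the invertible cotuple matches arrows out of \<open>B\<close> with
  arrows out of \<open>S\<close>, and it matches the two families of injections. The lemma serves to
  turn the invertibility in condition (ii) into a coproduct property of UF(A) itself.\<close>

lemma coproduct_transport_iso:
  assumes cop: "is_coproduct C I A S \<iota>" and B: "B \<in> Obj C"
    and f: "\<And>i. i \<in> I \<Longrightarrow> f i \<in> Hom C (A i) B"
    and iso: "is_iso C (cotuple C I S \<iota> B f)"
  shows "is_coproduct C I A B f"
proof -
  define c where "c = cotuple C I S \<iota> B f"
  have S: "S \<in> Obj C" and \<iota>: "\<And>i. i \<in> I \<Longrightarrow> \<iota> i \<in> Hom C (A i) S"
    using cop by (auto simp: is_coproduct_def)
  have univ: "\<exists>!u. u \<in> Hom C S E \<and> (\<forall>i\<in>I. u \<cdot>\<^bsub>C\<^esub> \<iota> i = k i)"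
    if "E \<in> Obj C" "\<And>i. i \<in> I \<Longrightarrow> k i \<in> Hom C (A i) E" for E k
    using cop that by (simp add: is_coproduct_def)
  have c: "c \<in> Hom C S B" "\<And>i. i \<in> I \<Longrightarrow> c \<cdot>\<^bsub>C\<^esub> \<iota> i = f i"
    using theI'[OF univ[OF B f]] by (auto simp: c_def cotuple_def)
  obtain d where d: "d \<in> Hom C B S" "d \<cdot>\<^bsub>C\<^esub> c = Idn C S" "c \<cdot>\<^bsub>C\<^esub> d = Idn C B"
    using iso c(1) by (auto simp: is_iso_def Hom_iff c_def[symmetric])
  \<comment> \<open>The inverse takes each \<open>f i\<close> back to the injection
    \<open>\<iota> i\<close>, so the mediating arrow from \<open>B\<close> is the one from
    \<open>S\<close> precomposed with \<open>d\<close>.\<close>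
  have df: "d \<cdot>\<^bsub>C\<^esub> f i = \<iota> i" if "i \<in> I" for i
    using c d \<iota>[OF that] that by (simp add: Hom_iff c(2)[symmetric] Comp_rewrite[OF d(2)])
  have "\<exists>!u. u \<in> Hom C B E \<and> (\<forall>i\<in>I. u \<cdot>\<^bsub>C\<^esub> f i = k i)"
    if E: "E \<in> Obj C" and k: "\<forall>i\<in>I. k i \<in> Hom C (A i) E" for E k
  proof -
    obtain v where v: "v \<in> Hom C S E" "\<And>i. i \<in> I \<Longrightarrow> v \<cdot>\<^bsub>C\<^esub> \<iota> i = k i"
      using univ[OF E] k by blast
    show ?thesis
    proof (intro ex1I conjI ballI)
      show "v \<cdot>\<^bsub>C\<^esub> d \<in> Hom C B E" using v d by (simp add: Hom_iff)
      show "(v \<cdot>\<^bsub>C\<^esub> d) \<cdot>\<^bsub>C\<^esub> f i = k i" if "i \<in> I" for i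
        using v d f[OF that] df[OF that] that by (simp add: Hom_iff)
      fix u assume u: "u \<in> Hom C B E \<and> (\<forall>i\<in>I. u \<cdot>\<^bsub>C\<^esub> f i = k i)"
      have "(u \<cdot>\<^bsub>C\<^esub> c) \<cdot>\<^bsub>C\<^esub> \<iota> i = k i" if "i \<in> I" for i
        using u c \<iota>[OF that] that by (simp add: Hom_iff)
      moreover have "u \<cdot>\<^bsub>C\<^esub> c \<in> Hom C S E" using u c by (simp add: Hom_iff)
      ultimately have "u \<cdot>\<^bsub>C\<^esub> c = v"
        using univ[OF E, of k] k v by blast
      then show "u = v \<cdot>\<^bsub>C\<^esub> d"
        using u c d by (auto simp: Hom_iff)
    qed
  qed
  then show ?thesis using B f by (simp add: is_coproduct_def)
qed

end

section \<open>Functors\<close>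

context cat_functor
begin

lemma fobj_Obj [simp]: "A \<in> Obj C \<Longrightarrow> fobj F A \<in> Obj D"
  by (rule fobj_in)

lemma farr_typing [simp]:
  assumes "f \<in> Arr C"
  shows "farr F f \<in> Arr D" "Dom D (farr F f) = fobj F (Dom C f)" "Cod D (farr F f) = fobj F (Cod C f)"
  using farr_in[of f "Dom C f" "Cod C f"] assms by (auto simp: Hom_def)

lemma farr_Comp': "\<lbrakk>f \<in> Arr C; g \<in> Arr C; Dom C g = Cod C f\<rbrakk>
    \<Longrightarrow> farr F (g \<cdot>\<^bsub>C\<^esub> f) = farr F g \<cdot>\<^bsub>D\<^esub> farr F f"
  by (rule farr_Comp) (simp_all add: Hom_def)

lemma farr_iso:
  assumes "is_iso C f"
  shows "is_iso D (farr F f)"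
proof -
  obtain g where f: "f \<in> Arr C" and g: "g \<in> Arr C" "Dom C g = Cod C f" "Cod C g = Dom C f"
    and gf: "g \<cdot>\<^bsub>C\<^esub> f = Idn C (Dom C f)" "f \<cdot>\<^bsub>C\<^esub> g = Idn C (Cod C f)"
    using assms by (auto simp: is_iso_def Hom_def)
  have "farr F g \<cdot>\<^bsub>D\<^esub> farr F f = Idn D (fobj F (Dom C f))"
    "farr F f \<cdot>\<^bsub>D\<^esub> farr F g = Idn D (fobj F (Cod C f))"
    using f g gf by (simp_all add: farr_Comp'[symmetric] farr_Idn)
  moreover have "farr F g \<in> Hom D (Cod D (farr F f)) (Dom D (farr F f))"
    using f g by (simp add: Hom_def)
  ultimately show ?thesis unfolding is_iso_def using f by auto
qed

end

lemma cat_functor_comp: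
  assumes "cat_functor C D S" "cat_functor D E R"
  shows "cat_functor C E (R \<bullet> S)"
proof -
  interpret S: cat_functor C D S by fact
  interpret R: cat_functor D E R by fact
  show ?thesis
    by unfold_locales
      (auto simp: comp_fctr_def Hom_def S.farr_Idn R.farr_Idn S.farr_Comp' R.farr_Comp')
qed

section \<open>Universal arrows and adjunctions\<close>

definition universal_arrow ::
  "('o, 'a) cat \<Rightarrow> ('p, 'b) cat \<Rightarrow> ('o, 'a, 'p, 'b) fctr \<Rightarrow> 'p \<Rightarrow> 'o \<Rightarrow> 'b \<Rightarrow> bool" where
  "universal_arrow C D S a Q \<theta> \<longleftrightarrow> Q \<in> Obj C \<and> \<theta> \<in> Hom D a (fobj S Q) \<and>
     (\<forall>B \<in> Obj C. \<forall>\<phi> \<in> Hom D a (fobj S B). \<exists>!u. u \<in> Hom C Q B \<and> farr S u \<cdot>\<^bsub>D\<^esub> \<theta> = \<phi>)"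

lemma universal_arrowD:
  assumes "universal_arrow C D S a Q \<theta>" "B \<in> Obj C" "\<phi> \<in> Hom D a (fobj S B)"
  shows "\<exists>!u. u \<in> Hom C Q B \<and> farr S u \<cdot>\<^bsub>D\<^esub> \<theta> = \<phi>"
  using assms(1)[unfolded universal_arrow_def, THEN conjunct2, THEN conjunct2, THEN bspec, OF assms(2),
    THEN bspec, OF assms(3)] .

context adjunction
begin

lemma unit_typing [simp]:
  assumes "A \<in> Obj C"
  shows "\<eta> A \<in> Arr C" "Dom C (\<eta> A) = A" "Cod C (\<eta> A) = fobj U (fobj F A)"
  using unit assms by (auto simp: nat_trans_def id_fctr_def comp_fctr_def Hom_def)

lemma counit_typing [simp]:
  assumes "B \<in> Obj D"
  shows "\<epsilon> B \<in> Arr D" "Dom D (\<epsilon> B) = fobj F (fobj U B)" "Cod D (\<epsilon> B) = B"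
  using counit assms by (auto simp: nat_trans_def id_fctr_def comp_fctr_def Hom_def)

lemma unit_natural: "f \<in> Arr C \<Longrightarrow> farr U (farr F f) \<cdot>\<^bsub>C\<^esub> \<eta> (Dom C f) = \<eta> (Cod C f) \<cdot>\<^bsub>C\<^esub> f"
  using unit by (auto simp: nat_trans_def id_fctr_def comp_fctr_def Hom_def)

lemma counit_natural: "f \<in> Arr D \<Longrightarrow> \<epsilon> (Cod D f) \<cdot>\<^bsub>D\<^esub> farr F (farr U f) = f \<cdot>\<^bsub>D\<^esub> \<epsilon> (Dom D f)"
  using counit by (auto simp: nat_trans_def id_fctr_def comp_fctr_def Hom_def)

text \<open>Naturality of the counit moves \<epsilon> past \<open>f\<close>, and the triangle
  identity on F removes what remains. Hence an arrow out of F(A) is determined by its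
  transpose.\<close>

lemma transpose_transpose:
  assumes "f \<in> Arr D" "A \<in> Obj C" "Dom D f = fobj F A"
  shows "\<epsilon> (Cod D f) \<cdot>\<^bsub>D\<^esub> farr F (farr U f \<cdot>\<^bsub>C\<^esub> \<eta> A) = f"
  using assms counit_natural[of f] triangle_F[of A]
  by (simp add: left.farr_Comp' left.target.Comp_rewrite[OF counit_natural])

lemma transpose_inj:
  assumes "f \<in> Arr D" "g \<in> Arr D" "A \<in> Obj C" "Dom D f = fobj F A" "Dom D g = fobj F A"
    and "Cod D f = Cod D g" and "farr U f \<cdot>\<^bsub>C\<^esub> \<eta> A = farr U g \<cdot>\<^bsub>C\<^esub> \<eta> A"
  shows "f = g"
  using assms transpose_transpose by metis

text \<open>The opposite round trip: naturality of the unit followed by the triangle identity on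
  U.\<close>

lemma transpose_counit:
  assumes "f \<in> Arr C" "B \<in> Obj D" "Cod C f = fobj U B"
  shows "farr U (\<epsilon> B \<cdot>\<^bsub>D\<^esub> farr F f) \<cdot>\<^bsub>C\<^esub> \<eta> (Dom C f) = f"
  using assms triangle_U[of B]
  by (simp add: right.farr_Comp' unit_natural left.source.Comp_rewrite[OF triangle_U])

text \<open>The two round trips of transposition give existence and uniqueness. The lemma is meant
  for the adjunction between L and K, where it makes L(A, \<zeta>) the target of a universal arrow
  from (A, \<zeta>) to K.\<close>

lemma unit_universal:
  assumes A: "A \<in> Obj C"
  shows "universal_arrow D C U A (fobj F A) (\<eta> A)"
  unfolding universal_arrow_def
proof (intro conjI ballI)
  fix B f assume B: "B \<in> Obj D" and f: "f \<in> Hom C A (fobj U B)"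
  show "\<exists>!u. u \<in> Hom D (fobj F A) B \<and> farr U u \<cdot>\<^bsub>C\<^esub> \<eta> A = f"
  proof (intro ex1I conjI)
    show "\<epsilon> B \<cdot>\<^bsub>D\<^esub> farr F f \<in> Hom D (fobj F A) B" using A B f by (simp add: Hom_def)
    show "farr U (\<epsilon> B \<cdot>\<^bsub>D\<^esub> farr F f) \<cdot>\<^bsub>C\<^esub> \<eta> A = f"
      using transpose_counit[of f B] B f by (simp add: Hom_def)
    fix u assume "u \<in> Hom D (fobj F A) B \<and> farr U u \<cdot>\<^bsub>C\<^esub> \<eta> A = f"
    then show "u = \<epsilon> B \<cdot>\<^bsub>D\<^esub> farr F f" using A transpose_transpose[of u A] by (auto simp: Hom_def)
  qed
qed (use A in \<open>simp_all add: Hom_def\<close>)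

end

section \<open>Equivalences of categories\<close>

lemma quasi_inverse_sym: "quasi_inverse C D S R \<Longrightarrow> quasi_inverse D C R S"
  by (auto simp: quasi_inverse_def)

lemma quasi_inverse_isoE:
  assumes "quasi_inverse C D S R"
  obtains \<alpha> where "\<And>A. A \<in> Obj C \<Longrightarrow> is_iso C (\<alpha> A)"
    and "\<And>A. A \<in> Obj C \<Longrightarrow> \<alpha> A \<in> Hom C (fobj R (fobj S A)) A"
    and "\<And>f A B. f \<in> Hom C A B \<Longrightarrow> \<alpha> B \<cdot>\<^bsub>C\<^esub> farr R (farr S f) = f \<cdot>\<^bsub>C\<^esub> \<alpha> A"
proof -
  obtain \<alpha> where "nat_iso C C (R \<bullet> S) id_fctr \<alpha>"
    using assms by (auto simp: quasi_inverse_def)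
  then show thesis
    by (intro that[of \<alpha>]) (auto simp: nat_iso_def nat_trans_def id_fctr_def comp_fctr_def)
qed

text \<open>By naturality of \<alpha>, both \<open>f\<close> and \<open>g\<close> agree after
  precomposition with the isomorphism \<open>\<alpha> A\<close>, which cancels.\<close>

lemma quasi_inverse_faithful:
  assumes qi: "quasi_inverse C D S R"
    and f: "f \<in> Hom C A B" and g: "g \<in> Hom C A B" and eq: "farr S f = farr S g"
  shows "f = g"
proof -
  interpret S: cat_functor C D S using qi by (simp add: quasi_inverse_def)
  obtain \<alpha> where iso: "\<And>A. A \<in> Obj C \<Longrightarrow> is_iso C (\<alpha> A)"
    and ty: "\<And>A. A \<in> Obj C \<Longrightarrow> \<alpha> A \<in> Hom C (fobj R (fobj S A)) A"
    and nat: "\<And>f A B. f \<in> Hom C A B \<Longrightarrow> \<alpha> B \<cdot>\<^bsub>C\<^esub> farr R (farr S f) = f \<cdot>\<^bsub>C\<^esub> \<alpha> A"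
    by (rule quasi_inverse_isoE[OF qi]) (rule that)
  have A: "A \<in> Obj C" using f by (auto simp: Hom_def)
  have "f \<cdot>\<^bsub>C\<^esub> \<alpha> A = g \<cdot>\<^bsub>C\<^esub> \<alpha> A" using nat[OF f] nat[OF g] eq by simp
  then show ?thesis
    using S.source.iso_cancel_right[OF iso[OF A], of f g] ty[OF A] f g by (simp add: Hom_def)
qed

text \<open>The preimage is found through R: an arrow \<open>u\<close> is built with R(S(u)) =
  R(\<phi>), and R is faithful because the notion of quasi-inverse is symmetric.\<close>

lemma quasi_inverse_full:
  assumes qi: "quasi_inverse C D S R" and A: "A \<in> Obj C" and B: "B \<in> Obj C"
    and \<phi>: "\<phi> \<in> Hom D (fobj S A) (fobj S B)"
  shows "\<exists>u \<in> Hom C A B. farr S u = \<phi>"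
proof -
  interpret S: cat_functor C D S using qi by (simp add: quasi_inverse_def)
  interpret R: cat_functor D C R using qi by (simp add: quasi_inverse_def)
  obtain \<alpha> where iso: "\<And>A. A \<in> Obj C \<Longrightarrow> is_iso C (\<alpha> A)"
    and ty: "\<And>A. A \<in> Obj C \<Longrightarrow> \<alpha> A \<in> Hom C (fobj R (fobj S A)) A"
    and nat: "\<And>f A B. f \<in> Hom C A B \<Longrightarrow> \<alpha> B \<cdot>\<^bsub>C\<^esub> farr R (farr S f) = f \<cdot>\<^bsub>C\<^esub> \<alpha> A"
    by (rule quasi_inverse_isoE[OF qi]) (rule that)
  obtain j where j: "j \<in> Hom C A (fobj R (fobj S A))" "j \<cdot>\<^bsub>C\<^esub> \<alpha> A = Idn C (fobj R (fobj S A))"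
    using iso[OF A] ty[OF A] by (auto simp: is_iso_def Hom_def)
  \<comment> \<open>This is \<open>farr R \<phi>\<close> conjugated by \<alpha>, the only choice
    that naturality of \<alpha> permits.\<close>
  define u where "u = \<alpha> B \<cdot>\<^bsub>C\<^esub> (farr R \<phi> \<cdot>\<^bsub>C\<^esub> j)"
  have u: "u \<in> Hom C A B" using ty[OF B] \<phi> j by (simp add: Hom_def u_def)
  have "\<alpha> B \<cdot>\<^bsub>C\<^esub> farr R (farr S u) = \<alpha> B \<cdot>\<^bsub>C\<^esub> farr R \<phi>"
    unfolding nat[OF u] using ty[OF A] ty[OF B] \<phi> j by (simp add: Hom_def u_def)
  then have "farr R (farr S u) = farr R \<phi>"
    using S.source.iso_cancel_left[OF iso[OF B]] ty[OF B] u \<phi> by (simp add: Hom_def)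
  then have "farr S u = \<phi>"
    using quasi_inverse_faithful[OF quasi_inverse_sym[OF qi]] S.farr_in[OF u] \<phi> by blast
  then show ?thesis using u by blast
qed

text \<open>The universal arrow \<theta> is the inverse of the isomorphism \<open>\<beta> a\<close>
  from S(R(a)) to \<open>a\<close>. Cancelling it turns the universal property into the bijection
  between arrows R(a) \<rightarrow> B and arrows S(R(a)) \<rightarrow> S(B), that is, into S being
  full and faithful.\<close>

lemma quasi_inverse_universal:
  assumes qi: "quasi_inverse C D S R" and a: "a \<in> Obj D"
  shows "\<exists>\<theta>. universal_arrow C D S a (fobj R a) \<theta>"
proof -
  interpret S: cat_functor C D S using qi by (simp add: quasi_inverse_def)
  interpret R: cat_functor D C R using qi by (simp add: quasi_inverse_def)
  obtain \<beta> where iso: "\<And>A. A \<in> Obj D \<Longrightarrow> is_iso D (\<beta> A)"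
    and ty: "\<And>A. A \<in> Obj D \<Longrightarrow> \<beta> A \<in> Hom D (fobj S (fobj R A)) A"
    and "\<And>f A B. f \<in> Hom D A B \<Longrightarrow> \<beta> B \<cdot>\<^bsub>D\<^esub> farr S (farr R f) = f \<cdot>\<^bsub>D\<^esub> \<beta> A"
    by (rule quasi_inverse_isoE[OF quasi_inverse_sym[OF qi]]) (rule that)
  obtain \<theta> where \<theta>: "\<theta> \<in> Hom D a (fobj S (fobj R a))"
    "\<theta> \<cdot>\<^bsub>D\<^esub> \<beta> a = Idn D (fobj S (fobj R a))" "\<beta> a \<cdot>\<^bsub>D\<^esub> \<theta> = Idn D a"
    using iso[OF a] ty[OF a] by (auto simp: is_iso_def Hom_def)
  have "\<exists>!u. u \<in> Hom C (fobj R a) B \<and> farr S u \<cdot>\<^bsub>D\<^esub> \<theta> = \<phi>"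
    if B: "B \<in> Obj C" and \<phi>: "\<phi> \<in> Hom D a (fobj S B)" for B \<phi>
  proof -
    have key: "farr S u \<cdot>\<^bsub>D\<^esub> \<theta> = \<phi> \<longleftrightarrow> farr S u = \<phi> \<cdot>\<^bsub>D\<^esub> \<beta> a" if u: "u \<in> Hom C (fobj R a) B" for u
    proof
      assume "farr S u \<cdot>\<^bsub>D\<^esub> \<theta> = \<phi>"
      then have "\<phi> \<cdot>\<^bsub>D\<^esub> \<beta> a = (farr S u \<cdot>\<^bsub>D\<^esub> \<theta>) \<cdot>\<^bsub>D\<^esub> \<beta> a" by simp
      also have "\<dots> = farr S u" using u \<theta> ty[OF a] by (simp add: Hom_def)
      finally show "farr S u = \<phi> \<cdot>\<^bsub>D\<^esub> \<beta> a" by simp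
    next
      assume "farr S u = \<phi> \<cdot>\<^bsub>D\<^esub> \<beta> a"
      then show "farr S u \<cdot>\<^bsub>D\<^esub> \<theta> = \<phi>" using \<phi> \<theta> ty[OF a] by (simp add: Hom_def)
    qed
    have "\<phi> \<cdot>\<^bsub>D\<^esub> \<beta> a \<in> Hom D (fobj S (fobj R a)) (fobj S B)"
      using \<phi> ty[OF a] by (simp add: Hom_def)
    then obtain u where u: "u \<in> Hom C (fobj R a) B" "farr S u = \<phi> \<cdot>\<^bsub>D\<^esub> \<beta> a"
      using quasi_inverse_full[OF qi R.fobj_in[OF a] B] by blast
    show ?thesis
    proof (intro ex1I conjI)
      show "u \<in> Hom C (fobj R a) B" "farr S u \<cdot>\<^bsub>D\<^esub> \<theta> = \<phi>"
        using u key[OF u(1)] by blast+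
      fix v assume "v \<in> Hom C (fobj R a) B \<and> farr S v \<cdot>\<^bsub>D\<^esub> \<theta> = \<phi>"
      then have v: "v \<in> Hom C (fobj R a) B" "farr S v = farr S u" using u(2) key[of v] by simp_all
      show "v = u" by (rule quasi_inverse_faithful[OF qi v(1) u(1) v(2)])
    qed
  qed
  then have "universal_arrow C D S a (fobj R a) \<theta>"
    unfolding universal_arrow_def using \<theta>(1) R.fobj_in[OF a] by (intro conjI ballI)
  then show ?thesis ..
qed

text \<open>Since \<open>J\<close> and \<open>J'\<close> are strictly inverse, they cancel inside
  the first round trip and \<alpha> can be reused unchanged. For the second round trip \<beta> is
  carried over to \<open>E\<close> by \<open>J\<close>.\<close>

lemma quasi_inverse_comp_isomorphism:
  assumes qi: "quasi_inverse C D S R"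
    and J: "cat_functor D E J" and J': "cat_functor E D J'"
    and J'J: "fctr_eq D (J' \<bullet> J) id_fctr" and JJ': "fctr_eq E (J \<bullet> J') id_fctr"
  shows "quasi_inverse C E (J \<bullet> S) (R \<bullet> J')"
proof -
  interpret S: cat_functor C D S using qi by (simp add: quasi_inverse_def)
  interpret R: cat_functor D C R using qi by (simp add: quasi_inverse_def)
  interpret J: cat_functor D E J by fact
  interpret J': cat_functor E D J' by fact
  have inv [simp]:
    "a \<in> Obj D \<Longrightarrow> fobj J' (fobj J a) = a" "f \<in> Arr D \<Longrightarrow> farr J' (farr J f) = f"
    "e \<in> Obj E \<Longrightarrow> fobj J (fobj J' e) = e" "k \<in> Arr E \<Longrightarrow> farr J (farr J' k) = k" for a f e k
    using J'J JJ' by (auto simp: fctr_eq_def comp_fctr_def id_fctr_def)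
  obtain \<alpha> where \<alpha>: "\<And>A. A \<in> Obj C \<Longrightarrow> is_iso C (\<alpha> A)"
    "\<And>A. A \<in> Obj C \<Longrightarrow> \<alpha> A \<in> Hom C (fobj R (fobj S A)) A"
    "\<And>f A B. f \<in> Hom C A B \<Longrightarrow> \<alpha> B \<cdot>\<^bsub>C\<^esub> farr R (farr S f) = f \<cdot>\<^bsub>C\<^esub> \<alpha> A"
    by (rule quasi_inverse_isoE[OF qi]) (rule that)
  have "nat_iso C C ((R \<bullet> J') \<bullet> (J \<bullet> S)) id_fctr \<alpha>"
    using \<alpha> by (auto simp: nat_iso_def nat_trans_def comp_fctr_def id_fctr_def Hom_def)
  moreover obtain \<beta> where \<beta>: "\<And>A. A \<in> Obj D \<Longrightarrow> is_iso D (\<beta> A)"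
    "\<And>A. A \<in> Obj D \<Longrightarrow> \<beta> A \<in> Hom D (fobj S (fobj R A)) A"
    "\<And>f A B. f \<in> Hom D A B \<Longrightarrow> \<beta> B \<cdot>\<^bsub>D\<^esub> farr S (farr R f) = f \<cdot>\<^bsub>D\<^esub> \<beta> A"
    by (rule quasi_inverse_isoE[OF quasi_inverse_sym[OF qi]]) (rule that)
  have "nat_iso E E ((J \<bullet> S) \<bullet> (R \<bullet> J')) id_fctr (\<lambda>e. farr J (\<beta> (fobj J' e)))"
    unfolding nat_iso_def nat_trans_def comp_fctr_def id_fctr_def fctr.simps
  proof (intro conjI ballI allI)
    fix e assume e: "e \<in> Obj E"
    show "farr J (\<beta> (fobj J' e)) \<in> Hom E (fobj J (fobj S (fobj R (fobj J' e)))) e"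
      using J.farr_in[OF \<beta>(2)[OF J'.fobj_in[OF e]]] e by simp
    show "is_iso E (farr J (\<beta> (fobj J' e)))" using \<beta>(1) e J.farr_iso by simp
  next
    fix A B f assume f: "f \<in> Hom E A B"
    have AB: "fobj J' A \<in> Obj D" "fobj J' B \<in> Obj D" using f by (auto simp: Hom_def)
    have "farr J (\<beta> (fobj J' B) \<cdot>\<^bsub>D\<^esub> farr S (farr R (farr J' f)))
        = farr J (farr J' f \<cdot>\<^bsub>D\<^esub> \<beta> (fobj J' A))"
      using \<beta>(3)[OF J'.farr_in[OF f]] by simp
    then show "farr J (\<beta> (fobj J' B)) \<cdot>\<^bsub>E\<^esub> farr J (farr S (farr R (farr J' f)))
        = f \<cdot>\<^bsub>E\<^esub> farr J (\<beta> (fobj J' A))"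
      using f \<beta>(2)[OF AB(1)] \<beta>(2)[OF AB(2)] by (simp add: J.farr_Comp' Hom_def)
  qed
  ultimately show ?thesis
    unfolding quasi_inverse_def
    using cat_functor_comp[OF S.cat_functor_axioms J] cat_functor_comp[OF J' R.cat_functor_axioms]
    by blast
qed

section \<open>Strict group actions and the category of cocycles\<close>

context G_category
begin

lemma act_typing [simp]:
  assumes "g \<in> carrier G"
  shows "A \<in> Obj C \<Longrightarrow> fobj (act g) A \<in> Obj C"
    and "f \<in> Arr C \<Longrightarrow> farr (act g) f \<in> Arr C"
    and "f \<in> Arr C \<Longrightarrow> Dom C (farr (act g) f) = fobj (act g) (Dom C f)"
    and "f \<in> Arr C \<Longrightarrow> Cod C (farr (act g) f) = fobj (act g) (Cod C f)"
proof -
  interpret cat_functor C C "act g" by (rule act_functor[OF assms])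
  show "A \<in> Obj C \<Longrightarrow> fobj (act g) A \<in> Obj C"
    "f \<in> Arr C \<Longrightarrow> farr (act g) f \<in> Arr C"
    "f \<in> Arr C \<Longrightarrow> Dom C (farr (act g) f) = fobj (act g) (Dom C f)"
    "f \<in> Arr C \<Longrightarrow> Cod C (farr (act g) f) = fobj (act g) (Cod C f)"
    by simp_all
qed

lemma act_Idn: "g \<in> carrier G \<Longrightarrow> A \<in> Obj C \<Longrightarrow> farr (act g) (Idn C A) = Idn C (fobj (act g) A)"
  by (rule cat_functor.farr_Idn[OF act_functor])

lemma act_Comp: "\<lbrakk>g \<in> carrier G; f \<in> Arr C; k \<in> Arr C; Dom C k = Cod C f\<rbrakk>
    \<Longrightarrow> farr (act g) (k \<cdot>\<^bsub>C\<^esub> f) = farr (act g) k \<cdot>\<^bsub>C\<^esub> farr (act g) f"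
  by (rule cat_functor.farr_Comp'[OF act_functor])

lemma act_one_simps [simp]:
  "A \<in> Obj C \<Longrightarrow> fobj (act \<one>\<^bsub>G\<^esub>) A = A"
  "f \<in> Arr C \<Longrightarrow> farr (act \<one>\<^bsub>G\<^esub>) f = f"
  using act_one by (auto simp: fctr_eq_def id_fctr_def)

lemma act_mult_simps:
  assumes "h \<in> carrier G" "g \<in> carrier G"
  shows "A \<in> Obj C \<Longrightarrow> fobj (act (h \<otimes>\<^bsub>G\<^esub> g)) A = fobj (act h) (fobj (act g) A)"
    and "f \<in> Arr C \<Longrightarrow> farr (act (h \<otimes>\<^bsub>G\<^esub> g)) f = farr (act h) (farr (act g) f)"
  using act_mult[OF assms] by (auto simp: fctr_eq_def comp_fctr_def)

lemma act_inv_simps: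
  assumes "g \<in> carrier G"
  shows "A \<in> Obj C \<Longrightarrow> fobj (act (inv\<^bsub>G\<^esub> g)) (fobj (act g) A) = A"
    and "f \<in> Arr C \<Longrightarrow> farr (act (inv\<^bsub>G\<^esub> g)) (farr (act g) f) = f"
  using assms act_mult_simps[of "inv\<^bsub>G\<^esub> g" g] by simp_all

lemma act_faithful:
  assumes "g \<in> carrier G" "u \<in> Arr C" "v \<in> Arr C" "farr (act g) u = farr (act g) v"
  shows "u = v"
  using assms act_inv_simps(2) by metis

lemma Z1_Obj_iff: "(A, \<xi>) \<in> Obj (Z1 G C act) \<longleftrightarrow>
    A \<in> Obj C \<and> \<xi> \<in> extensional (carrier G) \<and> \<xi> \<one>\<^bsub>G\<^esub> = Idn C A \<and>
    (\<forall>g \<in> carrier G. \<xi> g \<in> Arr C \<and> Dom C (\<xi> g) = fobj (act g) A \<and> Cod C (\<xi> g) = A) \<and>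
    (\<forall>g \<in> carrier G. \<forall>h \<in> carrier G. \<xi> (h \<otimes>\<^bsub>G\<^esub> g) = \<xi> h \<cdot>\<^bsub>C\<^esub> farr (act h) (\<xi> g))"
  by (auto simp: Z1_def cocycles_def PiE_iff Hom_iff)

lemma Z1_Arr_iff: "(a, f, b) \<in> Arr (Z1 G C act) \<longleftrightarrow>
    a \<in> Obj (Z1 G C act) \<and> b \<in> Obj (Z1 G C act) \<and> f \<in> Arr C \<and>
    Dom C f = fst a \<and> Cod C f = fst b \<and>
    (\<forall>g \<in> carrier G. f \<cdot>\<^bsub>C\<^esub> snd a g = snd b g \<cdot>\<^bsub>C\<^esub> farr (act g) f)"
  by (cases a; cases b) (auto simp: Z1_def Hom_iff)

lemma Z1_simps [simp]:
  "Dom (Z1 G C act) (a, f, b) = a" "Cod (Z1 G C act) (a, f, b) = b"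
  "Idn (Z1 G C act) a = (a, Idn C (fst a), a)"
  "(b', g, c) \<cdot>\<^bsub>Z1 G C act\<^esub> (a, f, b) = (a, g \<cdot>\<^bsub>C\<^esub> f, c)"
  by (simp_all add: Z1_def)

lemma Z1_category: "category (Z1 G C act)"
proof
  show "Dom (Z1 G C act) x \<in> Obj (Z1 G C act)" if "x \<in> Arr (Z1 G C act)" for x
    using that by (cases x) (simp add: Z1_Arr_iff)
  show "Cod (Z1 G C act) x \<in> Obj (Z1 G C act)" if "x \<in> Arr (Z1 G C act)" for x
    using that by (cases x) (simp add: Z1_Arr_iff)
  show "Idn (Z1 G C act) a \<in> Hom (Z1 G C act) a a" if "a \<in> Obj (Z1 G C act)" for a
    using that by (cases a) (simp add: Hom_def Z1_Arr_iff Z1_Obj_iff act_Idn)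
  fix x a b assume x: "x \<in> Hom (Z1 G C act) a b"
  obtain f where f: "x = (a, f, b)" using x by (cases x) (auto simp: Hom_def)
  show "x \<cdot>\<^bsub>Z1 G C act\<^esub> Idn (Z1 G C act) a = x" using x f by (simp add: Hom_def Z1_Arr_iff)
  show "Idn (Z1 G C act) b \<cdot>\<^bsub>Z1 G C act\<^esub> x = x" using x f by (simp add: Hom_def Z1_Arr_iff)
  fix y c assume y: "y \<in> Hom (Z1 G C act) b c"
  obtain k where k: "y = (b, k, c)" using y by (cases y) (auto simp: Hom_def)
  have arr: "f \<in> Arr C" "Dom C f = fst a" "Cod C f = fst b" "k \<in> Arr C" "Dom C k = fst b"
    "Cod C k = fst c" "a \<in> Obj (Z1 G C act)" "b \<in> Obj (Z1 G C act)" "c \<in> Obj (Z1 G C act)"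
    using x y f k by (simp_all add: Hom_def Z1_Arr_iff)
  have ty: "snd d g \<in> Arr C \<and> Dom C (snd d g) = fobj (act g) (fst d) \<and> Cod C (snd d g) = fst d"
    if "d \<in> Obj (Z1 G C act)" "g \<in> carrier G" for d g
    using that by (cases d) (simp add: Z1_Obj_iff)
  \<comment> \<open>The commuting squares of \<open>f\<close> and \<open>k\<close> are pasted side
    by side; functoriality of g(-) joins their edges g(f) and g(k).\<close>
  have "(k \<cdot>\<^bsub>C\<^esub> f) \<cdot>\<^bsub>C\<^esub> snd a g = snd c g \<cdot>\<^bsub>C\<^esub> farr (act g) (k \<cdot>\<^bsub>C\<^esub> f)" if g: "g \<in> carrier G" for g
  proof -
    have "(k \<cdot>\<^bsub>C\<^esub> f) \<cdot>\<^bsub>C\<^esub> snd a g = k \<cdot>\<^bsub>C\<^esub> (f \<cdot>\<^bsub>C\<^esub> snd a g)"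
      using arr ty g by simp
    also have "f \<cdot>\<^bsub>C\<^esub> snd a g = snd b g \<cdot>\<^bsub>C\<^esub> farr (act g) f"
      using x f g by (simp add: Hom_def Z1_Arr_iff)
    also have "k \<cdot>\<^bsub>C\<^esub> (snd b g \<cdot>\<^bsub>C\<^esub> farr (act g) f) = (k \<cdot>\<^bsub>C\<^esub> snd b g) \<cdot>\<^bsub>C\<^esub> farr (act g) f"
      using arr ty g by simp
    also have "k \<cdot>\<^bsub>C\<^esub> snd b g = snd c g \<cdot>\<^bsub>C\<^esub> farr (act g) k"
      using y k g by (simp add: Hom_def Z1_Arr_iff)
    finally show ?thesis using arr ty g by (simp add: act_Comp)
  qed
  then show "y \<cdot>\<^bsub>Z1 G C act\<^esub> x \<in> Hom (Z1 G C act) a c"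
    using arr f k by (simp add: Hom_def Z1_Arr_iff)
  fix z d assume z: "z \<in> Hom (Z1 G C act) c d"
  obtain l where l: "z = (c, l, d)" using z by (cases z) (auto simp: Hom_def)
  show "(z \<cdot>\<^bsub>Z1 G C act\<^esub> y) \<cdot>\<^bsub>Z1 G C act\<^esub> x = z \<cdot>\<^bsub>Z1 G C act\<^esub> (y \<cdot>\<^bsub>Z1 G C act\<^esub> x)"
    using z arr f k l by (simp add: Hom_def Z1_Arr_iff)
qed

end

section \<open>Condition (i): from algebras to cocycles\<close>

locale invariant_adjunction = G_category G C act + adjunction C D F U \<eta> \<epsilon>
  for G :: "('g, 'm) monoid_scheme" and C :: "('o, 'a) cat"
    and act :: "'g \<Rightarrow> ('o, 'a, 'o, 'a) fctr" and D :: "('p, 'b) cat"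
    and F :: "('o, 'a, 'p, 'b) fctr" and U :: "('p, 'b, 'o, 'a) fctr"
    and \<eta> :: "'o \<Rightarrow> 'a" and \<epsilon> :: "'p \<Rightarrow> 'b" +
  assumes invariant: "left_adjoint_invariant G C act F"
begin

abbreviation "EM \<equiv> adj_EM_cat C F U \<eta> \<epsilon>"
abbreviation "K \<equiv> comparison D U \<epsilon>"

lemma F_act [simp]:
  assumes "g \<in> carrier G"
  shows "A \<in> Obj C \<Longrightarrow> fobj F (fobj (act g) A) = fobj F A"
    and "f \<in> Arr C \<Longrightarrow> farr F (farr (act g) f) = farr F f"
  using invariant assms by (auto simp: left_adjoint_invariant_def fctr_eq_def comp_fctr_def)

text \<open>This is naturality of \<eta> at g(f), with F(g(f)) = F(f). It makes the arrows \<eta> at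
  g(A) a natural transformation from g(-) to UF, for each fixed g.\<close>

lemma unit_act_natural:
  "\<lbrakk>g \<in> carrier G; f \<in> Arr C\<rbrakk> \<Longrightarrow> farr U (farr F f) \<cdot>\<^bsub>C\<^esub> \<eta> (fobj (act g) (Dom C f))
     = \<eta> (fobj (act g) (Cod C f)) \<cdot>\<^bsub>C\<^esub> farr (act g) f"
  using unit_natural[of "farr (act g) f"] by simp

lemma EM_Obj_iff: "(A, \<zeta>) \<in> Obj EM \<longleftrightarrow>
    A \<in> Obj C \<and> \<zeta> \<in> Arr C \<and> Dom C \<zeta> = fobj U (fobj F A) \<and> Cod C \<zeta> = A \<and>
    \<zeta> \<cdot>\<^bsub>C\<^esub> \<eta> A = Idn C A \<and> \<zeta> \<cdot>\<^bsub>C\<^esub> farr U (farr F \<zeta>) = \<zeta> \<cdot>\<^bsub>C\<^esub> farr U (\<epsilon> (fobj F A))"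
  by (auto simp: adj_EM_cat_def EM_cat_def EM_algebras_def comp_fctr_def Hom_iff)

lemma EM_Arr_iff: "(a, f, b) \<in> Arr EM \<longleftrightarrow>
    a \<in> Obj EM \<and> b \<in> Obj EM \<and> f \<in> Arr C \<and> Dom C f = fst a \<and> Cod C f = fst b \<and>
    f \<cdot>\<^bsub>C\<^esub> snd a = snd b \<cdot>\<^bsub>C\<^esub> farr U (farr F f)"
  by (cases a; cases b) (auto simp: adj_EM_cat_def EM_cat_def comp_fctr_def Hom_iff)

lemma EM_simps [simp]:
  "Dom EM (a, f, b) = a" "Cod EM (a, f, b) = b"
  "Idn EM a = (a, Idn C (fst a), a)"
  "(b', g, c) \<cdot>\<^bsub>EM\<^esub> (a, f, b) = (a, g \<cdot>\<^bsub>C\<^esub> f, c)"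
  by (simp_all add: adj_EM_cat_def EM_cat_def)

lemma K_simps [simp]:
  "fobj K B = (fobj U B, farr U (\<epsilon> B))"
  "farr K u = (fobj K (Dom D u), farr U u, fobj K (Cod D u))"
  by (simp_all add: comparison_def Let_def)

text \<open>The unit law is a triangle identity; the associativity law is naturality of \<epsilon>
  at the arrow \<epsilon> at B, taken under U.\<close>

lemma K_Obj: "B \<in> Obj D \<Longrightarrow> fobj K B \<in> Obj EM"
  using triangle_U[of B] counit_natural[of "\<epsilon> B"]
  by (simp add: EM_Obj_iff right.farr_Comp'[symmetric])

text \<open>Naturality of the unit moves \<open>?\<xi>\<close> across \<eta>, where it becomes
  UF(\<open>?\<xi>\<close>). Associativity of \<zeta> then replaces UF(\<zeta>) by U(\<epsilon>),
  which cancels against UF(\<eta>).\<close>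

lemma algebra_cocycle_mult:
  assumes a: "(A, \<zeta>) \<in> Obj EM" and g: "g \<in> carrier G" and h: "h \<in> carrier G"
  shows "\<zeta> \<cdot>\<^bsub>C\<^esub> \<eta> (fobj (act (h \<otimes>\<^bsub>G\<^esub> g)) A)
       = (\<zeta> \<cdot>\<^bsub>C\<^esub> \<eta> (fobj (act h) A)) \<cdot>\<^bsub>C\<^esub> farr (act h) (\<zeta> \<cdot>\<^bsub>C\<^esub> \<eta> (fobj (act g) A))"
proof -
  let ?\<xi> = "\<zeta> \<cdot>\<^bsub>C\<^esub> \<eta> (fobj (act g) A)"
  let ?e = "\<eta> (fobj (act h) (fobj (act g) A))"
  have A: "A \<in> Obj C" and \<zeta>: "\<zeta> \<in> Arr C" "Dom C \<zeta> = fobj U (fobj F A)" "Cod C \<zeta> = A"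
    and assoc: "\<zeta> \<cdot>\<^bsub>C\<^esub> farr U (farr F \<zeta>) = \<zeta> \<cdot>\<^bsub>C\<^esub> farr U (\<epsilon> (fobj F A))"
    using a by (auto simp: EM_Obj_iff)
  \<comment> \<open>The triangle identity is used at g(A) and not at A; the result concerns F(A)
    because F(g(A)) = F(A).\<close>
  have tri: "farr U (\<epsilon> (fobj F A)) \<cdot>\<^bsub>C\<^esub> farr U (farr F (\<eta> (fobj (act g) A)))
      = Idn C (fobj U (fobj F A))"
    using triangle_F[of "fobj (act g) A"] A g
    by (simp add: right.farr_Comp'[symmetric] right.farr_Idn)
  have "(\<zeta> \<cdot>\<^bsub>C\<^esub> \<eta> (fobj (act h) A)) \<cdot>\<^bsub>C\<^esub> farr (act h) ?\<xi>
      = \<zeta> \<cdot>\<^bsub>C\<^esub> (farr U (farr F ?\<xi>) \<cdot>\<^bsub>C\<^esub> ?e)"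
    using unit_act_natural[of h ?\<xi>] A \<zeta> g h by simp
  also have "\<dots> = \<zeta> \<cdot>\<^bsub>C\<^esub> (farr U (farr F \<zeta>) \<cdot>\<^bsub>C\<^esub> (farr U (farr F (\<eta> (fobj (act g) A))) \<cdot>\<^bsub>C\<^esub> ?e))"
    using A \<zeta> g h by (simp add: left.farr_Comp' right.farr_Comp')
  also have "\<dots> = \<zeta> \<cdot>\<^bsub>C\<^esub> (farr U (\<epsilon> (fobj F A)) \<cdot>\<^bsub>C\<^esub> (farr U (farr F (\<eta> (fobj (act g) A))) \<cdot>\<^bsub>C\<^esub> ?e))"
    using A \<zeta> g h Comp_rewrite[OF assoc] by simp
  also have "\<dots> = \<zeta> \<cdot>\<^bsub>C\<^esub> ?e"
    using A \<zeta> g h Comp_rewrite[OF tri] by simp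
  finally show ?thesis using A g h by (simp add: act_mult_simps)
qed

text \<open>F forgets the action, so F(h(\<xi>_g)) = F(\<xi>_g) and the cocycle law becomes
  multiplicativity; F(\<xi>) at the inverse of g is then an inverse of F(\<xi>_g). The laws are
  assumed one by one, without extensionality, so that the lemma also covers the unrestricted family
  coming from an algebra.\<close>

lemma cocycle_G_object:
  assumes A: "A \<in> Obj C"
    and \<xi>: "\<And>g. g \<in> carrier G \<Longrightarrow> \<xi> g \<in> Hom C (fobj (act g) A) A"
    and one: "\<xi> \<one>\<^bsub>G\<^esub> = Idn C A"
    and mult: "\<And>g h. \<lbrakk>g \<in> carrier G; h \<in> carrier G\<rbrakk>
      \<Longrightarrow> \<xi> (h \<otimes>\<^bsub>G\<^esub> g) = \<xi> h \<cdot>\<^bsub>C\<^esub> farr (act h) (\<xi> g)"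
  shows "G_object D G (fobj F A) (\<lambda>g. farr F (\<xi> g))"
proof -
  have ty: "farr F (\<xi> g) \<in> Hom D (fobj F A) (fobj F A)" if "g \<in> carrier G" for g
    using \<xi>[OF that] A that by (simp add: Hom_def)
  have F_mult: "farr F (\<xi> (h \<otimes>\<^bsub>G\<^esub> g)) = farr F (\<xi> h) \<cdot>\<^bsub>D\<^esub> farr F (\<xi> g)"
    if "g \<in> carrier G" "h \<in> carrier G" for g h
    using mult[OF that] \<xi>[OF that(1)] \<xi>[OF that(2)] that by (simp add: Hom_def left.farr_Comp')
  have "is_iso D (farr F (\<xi> g))" if g: "g \<in> carrier G" for g
  proof -
    have "farr F (\<xi> (inv\<^bsub>G\<^esub> g)) \<cdot>\<^bsub>D\<^esub> farr F (\<xi> g) = Idn D (fobj F A)"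
      "farr F (\<xi> g) \<cdot>\<^bsub>D\<^esub> farr F (\<xi> (inv\<^bsub>G\<^esub> g)) = Idn D (fobj F A)"
      using g A one by (simp_all add: F_mult[symmetric] left.farr_Idn)
    then show ?thesis
      using ty[OF g] ty[of "inv\<^bsub>G\<^esub> g"] g unfolding is_iso_def Hom_def by auto
  qed
  then show ?thesis
    using A ty F_mult by (auto simp: G_object_def hom_def Aut_group_def)
qed

lemma algebra_G_object:
  assumes "(A, \<zeta>) \<in> Obj EM"
  shows "G_object D G (fobj F A) (\<lambda>g. farr F (\<zeta> \<cdot>\<^bsub>C\<^esub> \<eta> (fobj (act g) A)))"
proof (rule cocycle_G_object[OF _ _ _ algebra_cocycle_mult[OF assms]])
qed (use assms in \<open>auto simp: EM_Obj_iff Hom_iff\<close>)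

definition to_cocycle :: "'o \<times> 'a \<Rightarrow> 'o \<times> ('g \<Rightarrow> 'a)" where
  "to_cocycle = (\<lambda>(A, \<zeta>). (A, \<lambda>g \<in> carrier G. \<zeta> \<cdot>\<^bsub>C\<^esub> \<eta> (fobj (act g) A)))"

lemma to_cocycle_Obj:
  assumes a: "a \<in> Obj EM"
  shows "to_cocycle a \<in> Obj (Z1 G C act)"
proof -
  obtain A \<zeta> where A: "a = (A, \<zeta>)" by force
  show ?thesis
    using a algebra_cocycle_mult[of A \<zeta>] unfolding A
    by (auto simp: to_cocycle_def Z1_Obj_iff EM_Obj_iff)
qed

end

section \<open>Condition (ii): testing arrows on components, and quotients\<close>

locale galois_data = invariant_adjunction G C act D F U \<eta> \<epsilon>
  for G :: "('g, 'm) monoid_scheme" and C :: "('o, 'a) cat"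
    and act :: "'g \<Rightarrow> ('o, 'a, 'o, 'a) fctr" and D :: "('p, 'b) cat"
    and F :: "('o, 'a, 'p, 'b) fctr" and U :: "('p, 'b, 'o, 'a) fctr"
    and \<eta> :: "'o \<Rightarrow> 'a" and \<epsilon> :: "'p \<Rightarrow> 'b" +
  assumes unit_coproduct: "unit_coproduct_condition G C act F U \<eta>"
begin

text \<open>Some coproduct of the g(A) exists, and its comparison arrow to UF(A) is invertible, so
  the coproduct structure is transported to UF(A).\<close>

lemma UF_coproduct:
  assumes A: "A \<in> Obj C"
  shows "is_coproduct C (carrier G) (\<lambda>g. fobj (act g) A) (fobj U (fobj F A)) (\<lambda>g. \<eta> (fobj (act g) A))"
proof -
  have "has_coproducts C (carrier G)"
    using unit_coproduct by (simp add: unit_coproduct_condition_def)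
  then have "\<exists>S \<iota>. is_coproduct C (carrier G) (\<lambda>g. fobj (act g) A) S \<iota>"
    unfolding has_coproducts_def by (rule allE[of _ "\<lambda>g. fobj (act g) A"]) (use A in simp)
  then obtain S \<iota> where S: "is_coproduct C (carrier G) (\<lambda>g. fobj (act g) A) S \<iota>"
    by (elim exE)
  show ?thesis
  proof (rule coproduct_transport_iso[OF S])
    show "is_iso C (cotuple C (carrier G) S \<iota> (fobj U (fobj F A)) (\<lambda>g. \<eta> (fobj (act g) A)))"
      using unit_coproduct A S by (simp add: unit_coproduct_condition_def)
  qed (use A in \<open>simp_all add: Hom_iff\<close>)
qed

text \<open>Both arrows solve the same mediating problem for the coproduct UF(A). This is the main
  device for proving equations between arrows out of UF(A).\<close>

lemma UF_ext:
  assumes A: "A \<in> Obj C" and u: "u \<in> Hom C (fobj U (fobj F A)) B" and v: "v \<in> Hom C (fobj U (fobj F A)) B"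
    and eq: "\<And>g. g \<in> carrier G \<Longrightarrow> u \<cdot>\<^bsub>C\<^esub> \<eta> (fobj (act g) A) = v \<cdot>\<^bsub>C\<^esub> \<eta> (fobj (act g) A)"
  shows "u = v"
proof -
  have B: "B \<in> Obj C" using u by (auto simp: Hom_iff)
  have "\<forall>g \<in> carrier G. v \<cdot>\<^bsub>C\<^esub> \<eta> (fobj (act g) A) \<in> Hom C (fobj (act g) A) B"
    using v A by (auto simp: Hom_iff)
  then have "\<exists>!w. w \<in> Hom C (fobj U (fobj F A)) B \<and>
      (\<forall>g \<in> carrier G. w \<cdot>\<^bsub>C\<^esub> \<eta> (fobj (act g) A) = v \<cdot>\<^bsub>C\<^esub> \<eta> (fobj (act g) A))"
    using UF_coproduct[OF A] B unfolding is_coproduct_def by simp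
  then show ?thesis using u v eq by blast
qed

text \<open>Acting with the inverse of g reduces the claim to \<open>UF_ext\<close>, since the
  action is strict and faithful. In effect g(UF(A)) is again a coproduct, with injections
  g(\<eta>).\<close>

lemma act_UF_ext:
  assumes A: "A \<in> Obj C" and g: "g \<in> carrier G"
    and u: "u \<in> Hom C (fobj (act g) (fobj U (fobj F A))) B"
    and v: "v \<in> Hom C (fobj (act g) (fobj U (fobj F A))) B"
    and eq: "\<And>h. h \<in> carrier G \<Longrightarrow> u \<cdot>\<^bsub>C\<^esub> farr (act g) (\<eta> (fobj (act h) A))
      = v \<cdot>\<^bsub>C\<^esub> farr (act g) (\<eta> (fobj (act h) A))"
  shows "u = v"
proof -
  let ?i = "inv\<^bsub>G\<^esub> g"
  have push: "farr (act ?i) (w \<cdot>\<^bsub>C\<^esub> farr (act g) (\<eta> (fobj (act h) A)))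
      = farr (act ?i) w \<cdot>\<^bsub>C\<^esub> \<eta> (fobj (act h) A)"
    if "w \<in> Hom C (fobj (act g) (fobj U (fobj F A))) B" "h \<in> carrier G" for w h
    using that A g by (simp add: Hom_iff act_Comp act_inv_simps)
  have "farr (act ?i) u = farr (act ?i) v"
  proof (rule UF_ext[OF A])
    show "farr (act ?i) u \<in> Hom C (fobj U (fobj F A)) (fobj (act ?i) B)"
      "farr (act ?i) v \<in> Hom C (fobj U (fobj F A)) (fobj (act ?i) B)"
      using u v A g by (simp_all add: Hom_iff act_inv_simps)
    show "farr (act ?i) u \<cdot>\<^bsub>C\<^esub> \<eta> (fobj (act h) A) = farr (act ?i) v \<cdot>\<^bsub>C\<^esub> \<eta> (fobj (act h) A)"
      if "h \<in> carrier G" for h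
      using push[OF u that] push[OF v that] eq[OF that] by simp
  qed
  then show ?thesis using act_faithful[of ?i] u v g by (simp add: Hom_iff)
qed

text \<open>The right side says that the transpose t of \<open>f\<close> is an algebra morphism to
  K(B), where B is the codomain of \<open>f\<close>, because U(\<epsilon>) UF(t) = U(f). By
  \<open>key\<close>, its left-hand arrow has as component at g(A) the transpose of f F(\<xi>_g),
  while U(f) has the transpose of \<open>f\<close> there. The coproduct property gives one direction
  and injectivity of transposition the other.\<close>

lemma invariant_iff_algebra_morphism:
  assumes a: "(A, \<zeta>) \<in> Obj EM" and f: "f \<in> Arr D" "Dom D f = fobj F A"
  shows "(\<forall>g \<in> carrier G. f \<cdot>\<^bsub>D\<^esub> farr F (\<zeta> \<cdot>\<^bsub>C\<^esub> \<eta> (fobj (act g) A)) = f) \<longleftrightarrow>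
    (farr U f \<cdot>\<^bsub>C\<^esub> \<eta> A) \<cdot>\<^bsub>C\<^esub> \<zeta> = farr U f"
proof -
  have A: "A \<in> Obj C" and \<zeta>: "\<zeta> \<in> Arr C" "Dom C \<zeta> = fobj U (fobj F A)" "Cod C \<zeta> = A"
    using a by (auto simp: EM_Obj_iff)
  have key: "((farr U f \<cdot>\<^bsub>C\<^esub> \<eta> A) \<cdot>\<^bsub>C\<^esub> \<zeta>) \<cdot>\<^bsub>C\<^esub> \<eta> (fobj (act g) A)
      = farr U (f \<cdot>\<^bsub>D\<^esub> farr F (\<zeta> \<cdot>\<^bsub>C\<^esub> \<eta> (fobj (act g) A))) \<cdot>\<^bsub>C\<^esub> \<eta> (fobj (act g) A)"
    if g: "g \<in> carrier G" for g
    using unit_natural[of "\<zeta> \<cdot>\<^bsub>C\<^esub> \<eta> (fobj (act g) A)"] A \<zeta> f g by (simp add: right.farr_Comp')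
  show ?thesis
  proof
    assume inv: "\<forall>g \<in> carrier G. f \<cdot>\<^bsub>D\<^esub> farr F (\<zeta> \<cdot>\<^bsub>C\<^esub> \<eta> (fobj (act g) A)) = f"
    show "(farr U f \<cdot>\<^bsub>C\<^esub> \<eta> A) \<cdot>\<^bsub>C\<^esub> \<zeta> = farr U f"
    proof (rule UF_ext[OF A])
      show "(farr U f \<cdot>\<^bsub>C\<^esub> \<eta> A) \<cdot>\<^bsub>C\<^esub> \<zeta> \<in> Hom C (fobj U (fobj F A)) (fobj U (Cod D f))"
        "farr U f \<in> Hom C (fobj U (fobj F A)) (fobj U (Cod D f))"
        using A \<zeta> f by (simp_all add: Hom_iff)
      show "((farr U f \<cdot>\<^bsub>C\<^esub> \<eta> A) \<cdot>\<^bsub>C\<^esub> \<zeta>) \<cdot>\<^bsub>C\<^esub> \<eta> (fobj (act g) A) = farr U f \<cdot>\<^bsub>C\<^esub> \<eta> (fobj (act g) A)"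
        if "g \<in> carrier G" for g
        unfolding key[OF that] using inv that by simp
    qed
  next
    assume alg: "(farr U f \<cdot>\<^bsub>C\<^esub> \<eta> A) \<cdot>\<^bsub>C\<^esub> \<zeta> = farr U f"
    show "\<forall>g \<in> carrier G. f \<cdot>\<^bsub>D\<^esub> farr F (\<zeta> \<cdot>\<^bsub>C\<^esub> \<eta> (fobj (act g) A)) = f"
    proof
      fix g assume g: "g \<in> carrier G"
      have "farr U (f \<cdot>\<^bsub>D\<^esub> farr F (\<zeta> \<cdot>\<^bsub>C\<^esub> \<eta> (fobj (act g) A))) \<cdot>\<^bsub>C\<^esub> \<eta> (fobj (act g) A)
          = farr U f \<cdot>\<^bsub>C\<^esub> \<eta> (fobj (act g) A)"
        using key[OF g] by (simp only: alg)
      then show "f \<cdot>\<^bsub>D\<^esub> farr F (\<zeta> \<cdot>\<^bsub>C\<^esub> \<eta> (fobj (act g) A)) = f"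
        \<comment> \<open>Transposition is taken along g(A), which is legitimate because
          \<open>f\<close> also starts at F(g(A)) = F(A).\<close>
        using A \<zeta> f g by (intro transpose_inj[of _ _ "fobj (act g) A"]) simp_all
    qed
  qed
qed

text \<open>Transposition identifies invariant arrows F(A) \<rightarrow> B with algebra morphisms
  (A, \<zeta>) \<rightarrow> K(B), compatibly with composition, so one universal property translates
  into the other. The family \<rho> is prescribed only on \<open>carrier G\<close>, so that the
  values of a cocycle may be substituted for those computed from \<zeta>.\<close>

lemma universal_arrow_quotient:
  assumes a: "(A, \<zeta>) \<in> Obj EM" and univ: "universal_arrow D EM K (A, \<zeta>) Q \<theta>"
    and \<rho>: "\<And>g. g \<in> carrier G \<Longrightarrow> \<rho> g = farr F (\<zeta> \<cdot>\<^bsub>C\<^esub> \<eta> (fobj (act g) A))"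
  shows "\<exists>q. is_quotient D G (fobj F A) \<rho> Q q"
proof -
  have A: "A \<in> Obj C" using a by (auto simp: EM_Obj_iff)
  have Q: "Q \<in> Obj D" and \<theta>: "\<theta> \<in> Hom EM (A, \<zeta>) (fobj K Q)"
    using univ by (auto simp: universal_arrow_def)
  obtain t where t: "\<theta> = ((A, \<zeta>), t, fobj K Q)"
    using \<theta> by (cases \<theta>) (auto simp: Hom_def)
  have t': "t \<in> Arr C" "Dom C t = A" "Cod C t = fobj U Q"
    and t_alg: "t \<cdot>\<^bsub>C\<^esub> \<zeta> = farr U (\<epsilon> Q) \<cdot>\<^bsub>C\<^esub> farr U (farr F t)"
    using \<theta> unfolding t by (auto simp: Hom_def EM_Arr_iff)
  \<comment> \<open>The quotient arrow is the transpose of the arrow \<open>t\<close> underlying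
    \<theta>.\<close>
  define q where "q = \<epsilon> Q \<cdot>\<^bsub>D\<^esub> farr F t"
  have q: "q \<in> Arr D" "Dom D q = fobj F A" "Cod D q = Q"
    using Q t' by (simp_all add: q_def)
  have Uq: "farr U q \<cdot>\<^bsub>C\<^esub> \<eta> A = t"
    using transpose_counit[of t Q] Q t' by (simp add: q_def)
  have "(farr U q \<cdot>\<^bsub>C\<^esub> \<eta> A) \<cdot>\<^bsub>C\<^esub> \<zeta> = farr U q"
    unfolding Uq t_alg using Q t' by (simp add: q_def right.farr_Comp')
  then have q_inv: "\<forall>g \<in> carrier G. q \<cdot>\<^bsub>D\<^esub> \<rho> g = q"
    using invariant_iff_algebra_morphism[OF a q(1,2)] \<rho> by simp
  have "\<exists>!u. u \<in> Hom D Q B \<and> u \<cdot>\<^bsub>D\<^esub> q = f"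
    if f: "f \<in> Hom D (fobj F A) B" and inv: "\<forall>g \<in> carrier G. f \<cdot>\<^bsub>D\<^esub> \<rho> g = f" for B f
  proof -
    have f': "f \<in> Arr D" "Dom D f = fobj F A" "Cod D f = B" and B: "B \<in> Obj D"
      using f by (auto simp: Hom_def)
    let ?f = "farr U f \<cdot>\<^bsub>C\<^esub> \<eta> A"
    have "?f \<cdot>\<^bsub>C\<^esub> \<zeta> = farr U f"
      using invariant_iff_algebra_morphism[OF a f'(1,2)] \<rho> inv by simp
    also have "\<dots> = farr U (\<epsilon> B) \<cdot>\<^bsub>C\<^esub> farr U (farr F ?f)"
      using transpose_transpose[of f A] A f' B by (simp add: right.farr_Comp'[symmetric])
    finally have "((A, \<zeta>), ?f, fobj K B) \<in> Hom EM (A, \<zeta>) (fobj K B)"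
      using a K_Obj[OF B] A f' by (simp add: Hom_def EM_Arr_iff)
    then have ex1: "\<exists>!u. u \<in> Hom D Q B \<and> farr K u \<cdot>\<^bsub>EM\<^esub> \<theta> = ((A, \<zeta>), ?f, fobj K B)"
      by (rule universal_arrowD[OF univ B])
    have iff: "farr K u \<cdot>\<^bsub>EM\<^esub> \<theta> = ((A, \<zeta>), ?f, fobj K B) \<longleftrightarrow> u \<cdot>\<^bsub>D\<^esub> q = f"
      if u: "u \<in> Hom D Q B" for u
    proof -
      have u': "u \<in> Arr D" "Dom D u = Q" "Cod D u = B" using u by (auto simp: Hom_def)
      have "farr U (u \<cdot>\<^bsub>D\<^esub> q) \<cdot>\<^bsub>C\<^esub> \<eta> A = farr U u \<cdot>\<^bsub>C\<^esub> t"
        using u' q A by (simp add: right.farr_Comp' Uq)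
      then have "farr U u \<cdot>\<^bsub>C\<^esub> t = ?f \<longleftrightarrow> u \<cdot>\<^bsub>D\<^esub> q = f"
        using transpose_inj[of "u \<cdot>\<^bsub>D\<^esub> q" f A] u' q A f' by auto
      then show ?thesis using u' by (simp add: t)
    qed
    \<comment> \<open>The equivalence \<open>iff\<close> holds only for \<open>u\<close> in the
      hom-set, hence the congruence rule that supplies the first conjunct while the second is
      rewritten.\<close>
    show ?thesis using ex1 by (simp only: iff cong: conj_cong)
  qed
  then have "is_quotient D G (fobj F A) \<rho> Q q"
    using q q_inv unfolding is_quotient_def by (simp add: Hom_def)
  then show ?thesis ..
qed

section \<open>From cocycles back to algebras\<close>

definition to_algebra :: "'o \<times> ('g \<Rightarrow> 'a) \<Rightarrow> 'o \<times> 'a" where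
  "to_algebra = (\<lambda>(A, \<xi>). (A, THE \<zeta>. \<zeta> \<in> Hom C (fobj U (fobj F A)) A \<and>
     (\<forall>g \<in> carrier G. \<zeta> \<cdot>\<^bsub>C\<^esub> \<eta> (fobj (act g) A) = \<xi> g)))"

text \<open>A cocycle is in particular a family of arrows g(A) \<rightarrow> A, so the coproduct
  property of UF(A) makes the description in \<open>to_algebra\<close> definite: \<zeta> is the
  cotuple of the family.\<close>

lemma to_algebra_simps:
  assumes c: "(A, \<xi>) \<in> Obj (Z1 G C act)"
  obtains \<zeta> where "to_algebra (A, \<xi>) = (A, \<zeta>)" "\<zeta> \<in> Arr C" "Dom C \<zeta> = fobj U (fobj F A)" "Cod C \<zeta> = A"
    and "\<And>g. g \<in> carrier G \<Longrightarrow> \<zeta> \<cdot>\<^bsub>C\<^esub> \<eta> (fobj (act g) A) = \<xi> g"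
proof -
  have A: "A \<in> Obj C" and \<xi>: "\<forall>g \<in> carrier G. \<xi> g \<in> Hom C (fobj (act g) A) A"
    using c by (auto simp: Z1_Obj_iff Hom_iff)
  have "\<exists>!\<zeta>. \<zeta> \<in> Hom C (fobj U (fobj F A)) A \<and>
      (\<forall>g \<in> carrier G. \<zeta> \<cdot>\<^bsub>C\<^esub> \<eta> (fobj (act g) A) = \<xi> g)"
    using UF_coproduct[OF A] A \<xi> unfolding is_coproduct_def by simp
  from theI'[OF this] show thesis
    by (intro that[of "snd (to_algebra (A, \<xi>))"]) (simp_all add: to_algebra_def Hom_iff)
qed

text \<open>The unit law is the component at the neutral element. Associativity compares arrows out
  of UF(UF(A)), a coproduct of the objects g(UF(A)), which in turn are coproducts of the objects
  g(h(A)). On the component of g and h both sides equal \<xi>_{gh}.\<close>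

lemma to_algebra_Obj:
  assumes c: "c \<in> Obj (Z1 G C act)"
  shows "to_algebra c \<in> Obj EM"
proof -
  obtain A \<xi> where c': "c = (A, \<xi>)" by force
  obtain \<zeta> where alg: "to_algebra c = (A, \<zeta>)"
    and \<zeta>: "\<zeta> \<in> Arr C" "Dom C \<zeta> = fobj U (fobj F A)" "Cod C \<zeta> = A"
    and \<zeta>\<xi>: "\<And>g. g \<in> carrier G \<Longrightarrow> \<zeta> \<cdot>\<^bsub>C\<^esub> \<eta> (fobj (act g) A) = \<xi> g"
    using to_algebra_simps c unfolding c' by metis
  have A: "A \<in> Obj C" and one: "\<xi> \<one>\<^bsub>G\<^esub> = Idn C A"
    and \<xi>: "\<And>g. g \<in> carrier G \<Longrightarrow> \<xi> g \<in> Arr C \<and> Dom C (\<xi> g) = fobj (act g) A \<and> Cod C (\<xi> g) = A"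
    and mult: "\<And>g h. \<lbrakk>g \<in> carrier G; h \<in> carrier G\<rbrakk>
      \<Longrightarrow> \<xi> (g \<otimes>\<^bsub>G\<^esub> h) = \<xi> g \<cdot>\<^bsub>C\<^esub> farr (act g) (\<xi> h)"
    using c by (auto simp: Z1_Obj_iff c')
  let ?T = "fobj U (fobj F A)"
  have "\<zeta> \<cdot>\<^bsub>C\<^esub> \<eta> A = Idn C A" using \<zeta>\<xi>[of "\<one>\<^bsub>G\<^esub>"] A one by simp
  moreover have "\<zeta> \<cdot>\<^bsub>C\<^esub> farr U (farr F \<zeta>) = \<zeta> \<cdot>\<^bsub>C\<^esub> farr U (\<epsilon> (fobj F A))"
  proof (rule UF_ext)
    show "?T \<in> Obj C" using A by simp
    show "\<zeta> \<cdot>\<^bsub>C\<^esub> farr U (farr F \<zeta>) \<in> Hom C (fobj U (fobj F ?T)) A"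
      "\<zeta> \<cdot>\<^bsub>C\<^esub> farr U (\<epsilon> (fobj F A)) \<in> Hom C (fobj U (fobj F ?T)) A"
      using A \<zeta> by (simp_all add: Hom_iff)
    fix g assume g: "g \<in> carrier G"
    have left: "(\<zeta> \<cdot>\<^bsub>C\<^esub> farr U (farr F \<zeta>)) \<cdot>\<^bsub>C\<^esub> \<eta> (fobj (act g) ?T) = \<xi> g \<cdot>\<^bsub>C\<^esub> farr (act g) \<zeta>"
      using unit_act_natural[OF g, of \<zeta>] A \<zeta> g by (simp add: Comp_rewrite[OF \<zeta>\<xi>[OF g]])
    show "(\<zeta> \<cdot>\<^bsub>C\<^esub> farr U (farr F \<zeta>)) \<cdot>\<^bsub>C\<^esub> \<eta> (fobj (act g) ?T)
        = (\<zeta> \<cdot>\<^bsub>C\<^esub> farr U (\<epsilon> (fobj F A))) \<cdot>\<^bsub>C\<^esub> \<eta> (fobj (act g) ?T)"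
      unfolding left
    \<comment> \<open>First the outer coproduct fixed g; now the inner one, carried along by g(-),
      is tested on the components g(h(A)).\<close>
    proof (rule act_UF_ext[OF A g])
      show "\<xi> g \<cdot>\<^bsub>C\<^esub> farr (act g) \<zeta> \<in> Hom C (fobj (act g) ?T) A"
        "(\<zeta> \<cdot>\<^bsub>C\<^esub> farr U (\<epsilon> (fobj F A))) \<cdot>\<^bsub>C\<^esub> \<eta> (fobj (act g) ?T) \<in> Hom C (fobj (act g) ?T) A"
        using A \<zeta> g \<xi>[OF g] by (simp_all add: Hom_iff)
      fix h assume h: "h \<in> carrier G"
      let ?e = "\<eta> (fobj (act h) A)"
      have tri: "farr U (\<epsilon> (fobj F A)) \<cdot>\<^bsub>C\<^esub> farr U (farr F ?e) = Idn C ?T"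
        using triangle_F[of "fobj (act h) A"] A h
        by (simp add: right.farr_Comp'[symmetric] right.farr_Idn)
      have "(\<xi> g \<cdot>\<^bsub>C\<^esub> farr (act g) \<zeta>) \<cdot>\<^bsub>C\<^esub> farr (act g) ?e = \<xi> g \<cdot>\<^bsub>C\<^esub> farr (act g) (\<zeta> \<cdot>\<^bsub>C\<^esub> ?e)"
        using A \<zeta> g h \<xi>[OF g] by (simp add: act_Comp)
      \<comment> \<open>The cocycle law enters here, read from right to left for the product of g
        and h.\<close>
      also have "\<dots> = \<zeta> \<cdot>\<^bsub>C\<^esub> \<eta> (fobj (act g) (fobj (act h) A))"
        using \<zeta>\<xi>[of "g \<otimes>\<^bsub>G\<^esub> h"] \<zeta>\<xi>[OF h] A g h by (simp add: mult act_mult_simps)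
      also have "\<dots> = \<zeta> \<cdot>\<^bsub>C\<^esub> (farr U (\<epsilon> (fobj F A)) \<cdot>\<^bsub>C\<^esub>
          (farr U (farr F ?e) \<cdot>\<^bsub>C\<^esub> \<eta> (fobj (act g) (fobj (act h) A))))"
        using A \<zeta> g h by (simp add: Comp_rewrite[OF tri])
      also have "\<dots> = ((\<zeta> \<cdot>\<^bsub>C\<^esub> farr U (\<epsilon> (fobj F A))) \<cdot>\<^bsub>C\<^esub> \<eta> (fobj (act g) ?T)) \<cdot>\<^bsub>C\<^esub> farr (act g) ?e"
        using unit_act_natural[OF g, of ?e] A \<zeta> g h by simp
      finally show "(\<xi> g \<cdot>\<^bsub>C\<^esub> farr (act g) \<zeta>) \<cdot>\<^bsub>C\<^esub> farr (act g) ?e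
          = ((\<zeta> \<cdot>\<^bsub>C\<^esub> farr U (\<epsilon> (fobj F A))) \<cdot>\<^bsub>C\<^esub> \<eta> (fobj (act g) ?T)) \<cdot>\<^bsub>C\<^esub> farr (act g) ?e" .
    qed
  qed
  ultimately show ?thesis using A \<zeta> alg by (simp add: EM_Obj_iff)
qed

lemma to_cocycle_to_algebra:
  assumes c: "c \<in> Obj (Z1 G C act)"
  shows "to_cocycle (to_algebra c) = c"
proof -
  obtain A \<xi> where c': "c = (A, \<xi>)" by force
  obtain \<zeta> where "to_algebra c = (A, \<zeta>)"
    and "\<And>g. g \<in> carrier G \<Longrightarrow> \<zeta> \<cdot>\<^bsub>C\<^esub> \<eta> (fobj (act g) A) = \<xi> g"
    using to_algebra_simps c unfolding c' by metis
  \<comment> \<open>Off \<open>carrier G\<close> the restricted family is \<open>undefined\<close>;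
    extensionality of \<xi> makes the two families equal as functions.\<close>
  moreover have "\<xi> \<in> extensional (carrier G)" using c by (simp add: c' Z1_Obj_iff)
  ultimately show ?thesis
    by (auto simp: to_cocycle_def c' restrict_def extensional_def)
qed

lemma to_algebra_to_cocycle:
  assumes a: "a \<in> Obj EM"
  shows "to_algebra (to_cocycle a) = a"
proof -
  obtain A \<zeta> where a': "a = (A, \<zeta>)" by force
  have A: "A \<in> Obj C" and \<zeta>: "\<zeta> \<in> Hom C (fobj U (fobj F A)) A"
    using a by (auto simp: a' EM_Obj_iff Hom_iff)
  have "(THE \<kappa>. \<kappa> \<in> Hom C (fobj U (fobj F A)) A \<and>
      (\<forall>g \<in> carrier G. \<kappa> \<cdot>\<^bsub>C\<^esub> \<eta> (fobj (act g) A) = \<zeta> \<cdot>\<^bsub>C\<^esub> \<eta> (fobj (act g) A))) = \<zeta>"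
    using \<zeta> UF_ext[OF A] by (intro the_equality) auto
  then show ?thesis by (simp add: a' to_cocycle_def to_algebra_def)
qed

text \<open>Both sides of the algebra equation start at UF(A), so they may be compared on
  components; naturality of \<eta> at g(-) turns the component of the right side into the cocycle of
  \<open>b\<close> composed with g(f).\<close>

lemma algebra_morphism_iff_cocycle_morphism:
  assumes a: "a \<in> Obj EM" and b: "b \<in> Obj EM"
    and f: "f \<in> Arr C" "Dom C f = fst a" "Cod C f = fst b"
  shows "f \<cdot>\<^bsub>C\<^esub> snd a = snd b \<cdot>\<^bsub>C\<^esub> farr U (farr F f) \<longleftrightarrow>
    (\<forall>g \<in> carrier G. f \<cdot>\<^bsub>C\<^esub> snd (to_cocycle a) g = snd (to_cocycle b) g \<cdot>\<^bsub>C\<^esub> farr (act g) f)"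
proof -
  obtain A \<zeta> where a': "a = (A, \<zeta>)" by force
  obtain B \<kappa> where b': "b = (B, \<kappa>)" by force
  have A: "A \<in> Obj C" and \<zeta>: "\<zeta> \<in> Arr C" "Dom C \<zeta> = fobj U (fobj F A)" "Cod C \<zeta> = A"
    using a by (auto simp: a' EM_Obj_iff)
  have B: "B \<in> Obj C" and \<kappa>: "\<kappa> \<in> Arr C" "Dom C \<kappa> = fobj U (fobj F B)" "Cod C \<kappa> = B"
    using b by (auto simp: b' EM_Obj_iff)
  have f': "Dom C f = A" "Cod C f = B" using f by (auto simp: a' b')
  have "f \<cdot>\<^bsub>C\<^esub> \<zeta> = \<kappa> \<cdot>\<^bsub>C\<^esub> farr U (farr F f) \<longleftrightarrow>
    (\<forall>g \<in> carrier G. (f \<cdot>\<^bsub>C\<^esub> \<zeta>) \<cdot>\<^bsub>C\<^esub> \<eta> (fobj (act g) A) =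
      (\<kappa> \<cdot>\<^bsub>C\<^esub> farr U (farr F f)) \<cdot>\<^bsub>C\<^esub> \<eta> (fobj (act g) A))"
    using UF_ext[OF A, of "f \<cdot>\<^bsub>C\<^esub> \<zeta>" B "\<kappa> \<cdot>\<^bsub>C\<^esub> farr U (farr F f)"] f(1) f' \<zeta> \<kappa>
    by (auto simp: Hom_iff)
  also have "\<dots> \<longleftrightarrow> (\<forall>g \<in> carrier G. f \<cdot>\<^bsub>C\<^esub> (\<zeta> \<cdot>\<^bsub>C\<^esub> \<eta> (fobj (act g) A)) =
      (\<kappa> \<cdot>\<^bsub>C\<^esub> \<eta> (fobj (act g) B)) \<cdot>\<^bsub>C\<^esub> farr (act g) f)"
    using unit_act_natural[OF _ f(1)] f(1) f' A B \<zeta> \<kappa> by (intro ball_cong) auto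
  finally show ?thesis by (simp add: a' b' to_cocycle_def)
qed

section \<open>The strict isomorphism between algebras and cocycles\<close>

definition cocycle_functor where
  "cocycle_functor = \<lparr>fobj = to_cocycle, farr = (\<lambda>(a, f, b). (to_cocycle a, f, to_cocycle b))\<rparr>"

definition algebra_functor where
  "algebra_functor = \<lparr>fobj = to_algebra, farr = (\<lambda>(c, f, d). (to_algebra c, f, to_algebra d))\<rparr>"

lemma fst_to_cocycle [simp]: "fst (to_cocycle a) = fst a"
  by (simp add: to_cocycle_def split: prod.split)

lemma fst_to_algebra [simp]: "fst (to_algebra c) = fst c"
  by (simp add: to_algebra_def split: prod.split)

lemma cocycle_functor_Arr:
  "(a, f, b) \<in> Arr EM \<Longrightarrow> (to_cocycle a, f, to_cocycle b) \<in> Arr (Z1 G C act)"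
  using algebra_morphism_iff_cocycle_morphism[of a b f]
  by (auto simp: EM_Arr_iff Z1_Arr_iff to_cocycle_Obj)

lemma algebra_functor_Arr:
  "(c, f, d) \<in> Arr (Z1 G C act) \<Longrightarrow> (to_algebra c, f, to_algebra d) \<in> Arr EM"
  using algebra_morphism_iff_cocycle_morphism[of "to_algebra c" "to_algebra d" f]
  by (auto simp: EM_Arr_iff Z1_Arr_iff to_algebra_Obj to_cocycle_to_algebra)

text \<open>Underlying arrows are kept, so the functor laws are immediate. That \<open>EM\<close> is
  a category is assumed here and later read off from the quasi-inverse of K.\<close>

lemma cocycle_functor: "category EM \<Longrightarrow> cat_functor EM (Z1 G C act) cocycle_functor"
  by (intro cat_functor.intro cat_functor_axioms.intro Z1_category)
    (auto simp: cocycle_functor_def to_cocycle_Obj Hom_def cocycle_functor_Arr)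

lemma algebra_functor: "category EM \<Longrightarrow> cat_functor (Z1 G C act) EM algebra_functor"
  by (intro cat_functor.intro cat_functor_axioms.intro Z1_category)
    (auto simp: algebra_functor_def to_algebra_Obj Hom_def algebra_functor_Arr)

lemma algebra_cocycle_functor: "fctr_eq EM (algebra_functor \<bullet> cocycle_functor) id_fctr"
  by (auto simp: fctr_eq_def comp_fctr_def id_fctr_def algebra_functor_def cocycle_functor_def
    to_algebra_to_cocycle EM_Arr_iff)

lemma cocycle_algebra_functor: "fctr_eq (Z1 G C act) (cocycle_functor \<bullet> algebra_functor) id_fctr"
  by (auto simp: fctr_eq_def comp_fctr_def id_fctr_def algebra_functor_def cocycle_functor_def
    to_cocycle_to_algebra Z1_Arr_iff)

section \<open>Quotients from left adjoints and quasi-inverses of K\<close>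

lemma left_adjoint_of_comparison:
  assumes L: "adjunction EM D L K \<eta>' \<epsilon>'" and a: "(A, \<zeta>) \<in> Obj EM"
  shows "\<exists>q. is_quotient D G (fobj F A) (\<lambda>g. farr F (\<zeta> \<cdot>\<^bsub>C\<^esub> \<eta> (fobj (act g) A))) (fobj L (A, \<zeta>)) q"
  \<comment> \<open>The unit of the adjunction between L and K at (A, \<zeta>) is the universal
    arrow that is transposed.\<close>
  using universal_arrow_quotient[OF a adjunction.unit_universal[OF L a]] by simp

lemma equivalence_with_cocycles:
  assumes R: "quasi_inverse D EM K R"
  shows "quasi_inverse D (Z1 G C act) (cocycle_functor \<bullet> K) (R \<bullet> algebra_functor)"
proof -
  have "category EM" using R by (simp add: quasi_inverse_def cat_functor_def)
  then show ?thesis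
    by (intro quasi_inverse_comp_isomorphism[OF R] cocycle_functor algebra_functor
      algebra_cocycle_functor cocycle_algebra_functor)
qed

text \<open>The object in question is R applied to the algebra of the cocycle, hence the target of a
  universal arrow to K. The components of that algebra's structure map are the given
  \<xi>_g.\<close>

lemma quasi_inverse_quotient:
  assumes R: "quasi_inverse D EM K R" and c: "(A, \<xi>) \<in> Obj (Z1 G C act)"
  shows "\<exists>q. is_quotient D G (fobj F A) (\<lambda>g. farr F (\<xi> g)) (fobj (R \<bullet> algebra_functor) (A, \<xi>)) q"
proof -
  obtain \<zeta> where \<zeta>: "to_algebra (A, \<xi>) = (A, \<zeta>)"
    "\<And>g. g \<in> carrier G \<Longrightarrow> \<zeta> \<cdot>\<^bsub>C\<^esub> \<eta> (fobj (act g) A) = \<xi> g"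
    using to_algebra_simps[OF c] by metis
  have a: "(A, \<zeta>) \<in> Obj EM" using to_algebra_Obj[OF c] \<zeta> by simp
  show ?thesis
    using quasi_inverse_universal[OF R a] universal_arrow_quotient[OF a] \<zeta>
    by (simp add: comp_fctr_def algebra_functor_def) metis
qed

end

theorem theorem3p6:
  fixes G :: "('g, 'm) monoid_scheme"
    and X :: "('o, 'a) cat" and act :: "'g \<Rightarrow> ('o, 'a, 'o, 'a) fctr"
    and Y :: "('p, 'b) cat"
    and F :: "('o, 'a, 'p, 'b) fctr" and U :: "('p, 'b, 'o, 'a) fctr"
    and \<eta> :: "'o \<Rightarrow> 'a" and \<epsilon> :: "'p \<Rightarrow> 'b"
  assumes "group G" and "G_category G X act" and "category Y"
    and "adjunction X Y F U \<eta> \<epsilon>"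
  shows
    "(left_adjoint_invariant G X act F \<and> unit_coproduct_condition G X act F U \<eta> \<longrightarrow>
       (\<forall>L \<eta>' \<epsilon>'. adjunction (adj_EM_cat X F U \<eta> \<epsilon>) Y L (comparison Y U \<epsilon>) \<eta>' \<epsilon>' \<longrightarrow>
         (\<forall>(A, \<zeta>) \<in> Obj (adj_EM_cat X F U \<eta> \<epsilon>).
            let \<rho> = (\<lambda>g. farr F (\<zeta> \<cdot>\<^bsub>X\<^esub> \<eta> (fobj (act g) A)))
            in G_object Y G (fobj F A) \<rho> \<and>
               (\<exists>q. is_quotient Y G (fobj F A) \<rho> (fobj L (A, \<zeta>)) q))))
     \<and>
     (G_Galois_adjunction G X act Y F U \<eta> \<epsilon> \<longrightarrow>
       (\<exists>\<Phi> \<Psi>. quasi_inverse Y (Z1 G X act) \<Phi> \<Psi> \<and>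
         (\<forall>B \<in> Obj Y. fobj \<Phi> B =
            (fobj U B, \<lambda>g \<in> carrier G. farr U (\<epsilon> B) \<cdot>\<^bsub>X\<^esub> \<eta> (fobj (act g) (fobj U B)))) \<and>
         (\<forall>(A, \<xi>) \<in> Obj (Z1 G X act).
            let \<rho> = (\<lambda>g. farr F (\<xi> g))
            in G_object Y G (fobj F A) \<rho> \<and>
               (\<exists>q. is_quotient Y G (fobj F A) \<rho> (fobj \<Psi> (A, \<xi>)) q))))"
  proof (intro conjI impI)
  assume inv: "left_adjoint_invariant G X act F \<and> unit_coproduct_condition G X act F U \<eta>"
  interpret galois_data G X act Y F U \<eta> \<epsilon>
    using assms inv
    by (simp add: galois_data_def invariant_adjunction_def galois_data_axioms_def
      invariant_adjunction_axioms_def)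
  show "\<forall>L \<eta>' \<epsilon>'. adjunction EM Y L K \<eta>' \<epsilon>' \<longrightarrow> (\<forall>(A, \<zeta>) \<in> Obj EM.
      let \<rho> = (\<lambda>g. farr F (\<zeta> \<cdot>\<^bsub>X\<^esub> \<eta> (fobj (act g) A)))
      in G_object Y G (fobj F A) \<rho> \<and> (\<exists>q. is_quotient Y G (fobj F A) \<rho> (fobj L (A, \<zeta>)) q))"
    using algebra_G_object left_adjoint_of_comparison by (auto simp: Let_def)
next
  assume galois: "G_Galois_adjunction G X act Y F U \<eta> \<epsilon>"
  interpret galois_data G X act Y F U \<eta> \<epsilon>
    using assms galois
    by (simp add: galois_data_def invariant_adjunction_def galois_data_axioms_def
      invariant_adjunction_axioms_def G_Galois_adjunction_def)
  \<comment> \<open>Condition (iii) enters here. The equivalence is K followed by the isomorphism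
    from algebras to cocycles, and its quasi-inverse is built from \<open>R\<close>.\<close>
  obtain R where R: "quasi_inverse Y EM K R"
    using galois by (auto simp: G_Galois_adjunction_def monadic_def is_equivalence_def)
  have "G_object Y G (fobj F A) (\<lambda>g. farr F (\<xi> g))" if "(A, \<xi>) \<in> Obj (Z1 G X act)" for A \<xi>
    using that by (intro cocycle_G_object) (auto simp: Z1_Obj_iff Hom_def)
  moreover have "fobj (cocycle_functor \<bullet> K) B =
      (fobj U B, \<lambda>g \<in> carrier G. farr U (\<epsilon> B) \<cdot>\<^bsub>X\<^esub> \<eta> (fobj (act g) (fobj U B)))" for B
    by (simp add: comp_fctr_def cocycle_functor_def to_cocycle_def)
  ultimately show "\<exists>\<Phi> \<Psi>. quasi_inverse Y (Z1 G X act) \<Phi> \<Psi> \<and>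
      (\<forall>B \<in> Obj Y. fobj \<Phi> B =
         (fobj U B, \<lambda>g \<in> carrier G. farr U (\<epsilon> B) \<cdot>\<^bsub>X\<^esub> \<eta> (fobj (act g) (fobj U B)))) \<and>
      (\<forall>(A, \<xi>) \<in> Obj (Z1 G X act). let \<rho> = (\<lambda>g. farr F (\<xi> g))
         in G_object Y G (fobj F A) \<rho> \<and>
            (\<exists>q. is_quotient Y G (fobj F A) \<rho> (fobj \<Psi> (A, \<xi>)) q))"
    using equivalence_with_cocycles[OF R] quasi_inverse_quotient[OF R]
    by (intro exI[of _ "cocycle_functor \<bullet> K"] exI[of _ "R \<bullet> algebra_functor"]) (auto simp: Let_def)
qed

end
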